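(* For real $\omega\geq 0$ and $n\in\mathbb{Z}_+$, let $p_n^\omega$ denote the monic polynomial of degree $n$ satisfying $\int_{-1}^1 p_n^\omega(x)\,x^k\,{\mathrm e}^{{\mathrm i}\omega x}\,\mathrm{d}x=0$ for $k=0,1,\ldots,n-1$ (it exists and is unique exactly when $h_{n-1}(\omega)\neq 0$). Let $N\geq 1$ and let $c_1^{[N]},\ldots,c_N^{[N]}>0$ be the zeros of the $N$th Laguerre polynomial $\mathrm{L}_N(c)=\sum_{s=0}^N\frac{1}{s!}\binom{N}{s}(-c)^s$. Then for $\omega\gg 1$ the $2N$ zeros of $p_{2N}^\omega$ are \[ \pm 1+\frac{{\mathrm i}\,c_k^{[N]}}{\omega}+\mathcal{O}(\omega^{-2}),\qquad k=1,\ldots,N,\ \omega\to+\infty. \] The same holds for $p_{2N+1}^\omega$ (at those large $\omega$ for which it exists), except for a single additional zero lying on the imaginary axis.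
   Context: The moments are $\mu_k(\omega)=\int_{-1}^1 x^k{\mathrm e}^{{\mathrm i}\omega x}\,\mathrm{d}x$, and $h_{n}(\omega)=\det[\mu_{i+j}(\omega)]_{i,j=0}^{n}$ is the $(n+1)\times(n+1)$ Hankel determinant; $h_{-1}=1$. *)

theory Defs
  imports "HOL-Analysis.Analysis" "HOL-Computational_Algebra.Polynomial"
begin

definition mu :: "nat \<Rightarrow> real \<Rightarrow> complex" where
  "mu k \<omega> = integral {-1..1}
     (\<lambda>x::real. complex_of_real x ^ k * exp (\<i> * complex_of_real (\<omega> * x)))"

definition is_orth_poly :: "nat \<Rightarrow> real \<Rightarrow> complex poly \<Rightarrow> bool" where
  "is_orth_poly n \<omega> p \<longleftrightarrow> degree p = n \<and> lead_coeff p = 1 \<and>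
     (\<forall>k<n. integral {-1..1}
        (\<lambda>x::real. poly p (complex_of_real x) * complex_of_real x ^ k
                    * exp (\<i> * complex_of_real (\<omega> * x))) = 0)"

definition orth_poly_exists :: "nat \<Rightarrow> real \<Rightarrow> bool" where
  "orth_poly_exists n \<omega> \<longleftrightarrow> (\<exists>!p. is_orth_poly n \<omega> p)"

definition laguerre :: "nat \<Rightarrow> real \<Rightarrow> real" where
  "laguerre N c = (\<Sum>s\<le>N. (1 / fact s) * of_nat (N choose s) * (- c) ^ s)"

end

theory Submission
  imports Defs "HOL-Computational_Algebra.Computational_Algebra"
begin

text \<open>
  Put \<open>\<delta> = \<i> / \<omega>\<close> and let \<open>\<Lambda>\<close> be the Laguerre functional \<open>t\<^sup>m \<mapsto> m!\<close>. Integration by parts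
  turns \<open>\<integral> f(x) e\<^sup>i\<^sup>\<omega>\<^sup>x dx\<close> over \<open>[-1, 1]\<close> into \<open>\<delta>\<close> times the combination
  \<open>e\<^sup>-\<^sup>i\<^sup>\<omega> \<Lambda>(f(-1 + \<delta> t)) - e\<^sup>i\<^sup>\<omega> \<Lambda>(f(1 + \<delta> t))\<close> of endpoint functionals.
  Take the \<open>2N\<close> predicted zeros \<open>\<plusminus>1 + \<delta> c\<^sub>k\<close> as nodes, let \<open>W\<close> be the monic polynomial vanishing there
  and \<open>E\<^sub>j = W / (x - x\<^sub>j)\<close>. Write an orthogonal polynomial as \<open>p = s W + \<Sum> u\<^sub>j E\<^sub>j\<close> with \<open>s\<close> of degree
  at most one. Since the \<open>c\<^sub>k\<close> are the Laguerre nodes, the Gram matrix of the \<open>E\<^sub>j\<close> is diagonally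
  dominant for large \<open>\<omega>\<close>, while \<open>s W\<close> is almost orthogonal to every \<open>E\<^sub>j\<close>; this forces
  \<open>u\<^sub>j = O(\<bar>s\<bar> \<omega>\<^sup>-\<^sup>2)\<close>. As \<open>p\<close> has a zero within \<open>deg p \<cdot> \<bar>p/p'\<bar>\<close> of any point, it has one within
  \<open>O(\<omega>\<^sup>-\<^sup>2)\<close> of each node. In odd degree the symmetry \<open>x \<mapsto> -cnj x\<close> makes the zero of \<open>s\<close> imaginary,
  which keeps it away from the nodes, and also makes the remaining zero of \<open>p\<close> imaginary.
\<close>

subsection \<open>The Laguerre functional\<close>

text \<open>The integral of f(t) e^(-t) over t >= 0, encoded through its moments m! so that it is
  purely algebraic.\<close>

definition Lam :: "complex poly \<Rightarrow> complex" where
  "Lam f = (\<Sum>m\<le>degree f. coeff f m * fact m)"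

lemma Lam_altdef: "degree f \<le> n \<Longrightarrow> Lam f = (\<Sum>m\<le>n. coeff f m * fact m)"
  unfolding Lam_def by (rule sum.mono_neutral_left) (auto simp: coeff_eq_0)

lemma Lam_add: "Lam (f + g) = Lam f + Lam g"
proof -
  define n where "n = max (degree f) (degree g)"
  have "degree f \<le> n" "degree g \<le> n" "degree (f + g) \<le> n"
    by (auto simp: n_def degree_add_le_max)
  thus ?thesis by (simp add: Lam_altdef sum.distrib algebra_simps)
qed

lemma Lam_smult: "Lam (smult a f) = a * Lam f"
  using Lam_altdef[OF degree_smult_le[of a f]] by (simp add: Lam_def sum_distrib_left mult.assoc)

lemma Lam_0 [simp]: "Lam 0 = 0"
  by (simp add: Lam_def)

lemma Lam_const [simp]: "Lam [:a:] = a"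
  by (simp add: Lam_def)

lemma Lam_diff: "Lam (f - g) = Lam f - Lam g"
proof -
  have "f - g = f + smult (-1) g" by simp
  thus ?thesis by (simp only: Lam_add Lam_smult) simp
qed

lemma Lam_sum: "Lam (\<Sum>i\<in>A. f i) = (\<Sum>i\<in>A. Lam (f i))"
  by (induction A rule: infinite_finite_induct) (auto simp: Lam_add)

text \<open>Integration by parts against e^(-t); on coefficients it is the recursion (m+1)! = (m+1)
  m!.\<close>

lemma Lam_pderiv: "Lam (pderiv f) = Lam f - poly f 0"
proof -
  have "Lam f = (\<Sum>m\<le>Suc (degree f). coeff f m * fact m)"
    by (rule Lam_altdef) simp
  also have "\<dots> = coeff f 0 + (\<Sum>m\<le>degree f. coeff f (Suc m) * fact (Suc m))"
    by (subst sum.atMost_Suc_shift) simp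
  also have "(\<Sum>m\<le>degree f. coeff f (Suc m) * fact (Suc m)) = Lam (pderiv f)"
    by (subst Lam_altdef[of _ "degree f"])
       (auto simp: degree_pderiv coeff_pderiv algebra_simps intro!: sum.cong)
  finally show ?thesis by (simp add: poly_0_coeff_0)
qed

text \<open>The outer variable of \<open>F\<close> is the small parameter, the inner one the
  variable t of \<open>Lam\<close>; evaluation at \<open>[:\<delta>:]\<close> freezes the parameter.
  Horner's scheme gives one bound for the whole unit disc.\<close>

lemma Lam_poly_bounded:
  fixes F :: "complex poly poly"
  shows "\<exists>C\<ge>0. \<forall>\<delta>. cmod \<delta> \<le> 1 \<longrightarrow> cmod (Lam (poly F [:\<delta>:])) \<le> C"
proof (induction F)
  case 0
  show ?case by (rule exI[of _ 0]) simp
next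
  case (pCons a F)
  then obtain C where C: "C \<ge> 0" "\<And>\<delta>. cmod \<delta> \<le> 1 \<Longrightarrow> cmod (Lam (poly F [:\<delta>:])) \<le> C"
    by blast
  show ?case
  proof (rule exI[of _ "cmod (Lam a) + C"], intro conjI allI impI)
    fix \<delta> :: complex assume d: "cmod \<delta> \<le> 1"
    have "cmod (Lam (poly (pCons a F) [:\<delta>:])) = cmod (Lam a + \<delta> * Lam (poly F [:\<delta>:]))"
      by (simp add: Lam_add Lam_smult)
    also have "\<dots> \<le> cmod (Lam a) + cmod \<delta> * cmod (Lam (poly F [:\<delta>:]))"
      by (metis norm_mult norm_triangle_ineq)
    also have "\<dots> \<le> cmod (Lam a) + 1 * C"
      using d C by (intro add_left_mono mult_mono) auto
    finally show "cmod (Lam (poly (pCons a F) [:\<delta>:])) \<le> cmod (Lam a) + C" by simp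
  qed (use C in auto)
qed

text \<open>With F = a + delta G the difference is exactly delta times \<open>Lam\<close> of
  G(delta), which is bounded. This is the source of the error terms in the endpoint
  expansions.\<close>

lemma Lam_poly_limit:
  fixes F :: "complex poly poly"
  shows "\<exists>C\<ge>0. \<forall>\<delta>. cmod \<delta> \<le> 1 \<longrightarrow>
           cmod (Lam (poly F [:\<delta>:]) - Lam (poly F 0)) \<le> C * cmod \<delta>"
proof (cases F)
  case (pCons a G)
  obtain C where C: "C \<ge> 0" "\<And>\<delta>. cmod \<delta> \<le> 1 \<Longrightarrow> cmod (Lam (poly G [:\<delta>:])) \<le> C"
    using Lam_poly_bounded by blast
  have "cmod (Lam (poly F [:\<delta>:]) - Lam (poly F 0)) \<le> C * cmod \<delta>" if "cmod \<delta> \<le> 1" for \<delta>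
    using mult_left_mono[OF C(2)[OF that], of "cmod \<delta>"]
    by (simp add: pCons Lam_add Lam_smult norm_mult mult.commute)
  thus ?thesis using C by blast
qed

section \<open>Laguerre polynomials and their orthogonality\<close>

definition laguerre_poly :: "nat \<Rightarrow> complex poly" where
  "laguerre_poly N = (\<Sum>s\<le>N. monom ((-1) ^ s * of_nat (N choose s) / fact s) s)"

lemma coeff_laguerre_poly:
  "coeff (laguerre_poly N) s = (if s \<le> N then (-1) ^ s * of_nat (N choose s) / fact s else 0)"
  by (auto simp: laguerre_poly_def coeff_sum)

lemma degree_laguerre_poly: "degree (laguerre_poly N) = N"
proof (rule antisym)
  show "degree (laguerre_poly N) \<le> N"
    by (rule degree_le) (simp add: coeff_laguerre_poly)
  show "N \<le> degree (laguerre_poly N)"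
    by (rule le_degree) (simp add: coeff_laguerre_poly)
qed

lemma poly_laguerre_poly: "poly (laguerre_poly N) (of_real x) = of_real (laguerre N x)"
  unfolding laguerre_poly_def laguerre_def poly_sum of_real_sum
  by (intro sum.cong) (auto simp: poly_monom power_minus')

text \<open>Since (s+k)!/s! is k! times a binomial coefficient, which the sign (-1)^s turns into
  (-k-1 over s), the sum is a Vandermonde convolution. The factor (N-k-1 over N) is 0 for k < N and
  (-1)^N for k = N.\<close>

lemma Lam_laguerre_monom:
  assumes "k \<le> N"
  shows "Lam (laguerre_poly N * monom 1 k) = fact k * ((of_nat N - of_nat k - 1) gchoose N)"
proof -
  have "degree (laguerre_poly N * monom 1 k) \<le> N + k"
    using degree_mult_le[of "laguerre_poly N" "monom 1 k"] 
    by (simp add: degree_laguerre_poly degree_monom_eq)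
  hence "Lam (laguerre_poly N * monom 1 k) = (\<Sum>m\<le>N+k. coeff (laguerre_poly N * monom 1 k) m * fact m)"
    by (rule Lam_altdef)
  also have "\<dots> = (\<Sum>m\<in>(\<lambda>s. s + k) ` {..N}. coeff (laguerre_poly N * monom 1 k) m * fact m)"
  proof (rule sum.mono_neutral_right)
    show "\<forall>i\<in>{..N + k} - (\<lambda>s. s + k) ` {..N}. coeff (laguerre_poly N * monom 1 k) i * fact i = 0"
    proof
      fix i assume i: "i \<in> {..N + k} - (\<lambda>s. s + k) ` {..N}"
      have "i < k"
      proof (rule ccontr)
        assume "\<not> i < k"
        hence "i = (i - k) + k" "i - k \<le> N" using i by auto
        with i show False by blast
      qed
      thus "coeff (laguerre_poly N * monom 1 k) i * fact i = 0"
        by (simp add: mult.commute[of _ "monom 1 k"] coeff_monom_mult)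
    qed
  qed auto
  also have "\<dots> = (\<Sum>s\<le>N. coeff (laguerre_poly N) s * fact (s + k))"
    by (subst sum.reindex) (auto simp: inj_on_def mult.commute[of _ "monom 1 k"] coeff_monom_mult)
  also have "\<dots> = fact k * (\<Sum>s\<le>N. ((- of_nat k - 1) gchoose s) * (of_nat N gchoose (N - s)))"
    unfolding sum_distrib_left
  proof (rule sum.cong)
    fix s assume s: "s \<in> {..N}"
    have "((- of_nat k - 1) gchoose s) = (-1) ^ s * ((of_nat (s + k) :: complex) gchoose s)"
      by (subst gbinomial_negated_upper) (simp add: algebra_simps)
    also have "\<dots> = (-1) ^ s * (of_nat (s + k choose s))"
      by (simp only: binomial_gbinomial)
    also have "\<dots> = (-1) ^ s * (fact (s + k) / (fact s * fact k))"
      by (subst binomial_fact) auto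
    finally have "((- of_nat k - 1) gchoose s) = (-1) ^ s * (fact (s + k) / (fact s * fact k) :: complex)" .
    moreover have "((of_nat N :: complex) gchoose (N - s)) = of_nat (N choose s)"
      using s by (simp only: binomial_gbinomial[symmetric]) (subst binomial_symmetric; simp)
    ultimately show "coeff (laguerre_poly N) s * fact (s + k) =
       fact k * (((- of_nat k - 1) gchoose s) * (of_nat N gchoose (N - s)))"
      using s by (simp add: coeff_laguerre_poly field_simps)
  qed auto
  also have "(\<Sum>s\<le>N. ((- of_nat k - 1) gchoose s) * ((of_nat N :: complex) gchoose (N - s)))
     = ((- of_nat k - 1 + of_nat N) gchoose N)"
    unfolding atMost_atLeast0 by (rule gbinomial_Vandermonde)
  finally show ?thesis by (simp add: algebra_simps)
qed

lemma Lam_laguerre_eq_0: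
  assumes "degree f < N"
  shows "Lam (laguerre_poly N * f) = 0"
proof -
  have z: "Lam (laguerre_poly N * monom 1 k) = 0" if "k < N" for k
  proof -
    have "(of_nat N - of_nat k - 1 :: complex) = of_nat (N - k - 1)"
      using that by (simp add: of_nat_diff)
    moreover have "((of_nat (N - k - 1) :: complex) gchoose N) = 0"
      by (subst binomial_gbinomial[symmetric]) (use that in \<open>simp add: binomial_eq_0\<close>)
    ultimately show ?thesis
      using Lam_laguerre_monom[of k N] that by (metis less_imp_le mult_zero_right)
  qed
  have "laguerre_poly N * f = (\<Sum>i\<le>degree f. smult (coeff f i) (laguerre_poly N * monom 1 i))"
    by (subst poly_as_sum_of_monoms[symmetric]) 
       (simp add: sum_distrib_left mult_smult_right[symmetric] smult_monom del: mult_smult_right)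
  also have "Lam \<dots> = 0"
    unfolding Lam_sum Lam_smult using assms by (intro sum.neutral) (auto simp: z)
  finally show ?thesis .
qed

text \<open>By orthogonality only the leading term of \<open>f\<close> contributes, and t^N itself
  gives (-1)^N N!.\<close>

lemma Lam_laguerre_neq_0:
  assumes "degree f = N" "f \<noteq> 0"
  shows "Lam (laguerre_poly N * f) \<noteq> 0"
proof -
  have z: "Lam (laguerre_poly N * monom 1 N) \<noteq> 0"
    by (subst Lam_laguerre_monom) (auto simp: gbinomial_negated_upper[of "-1"] simp flip: binomial_gbinomial)
  define r where "r = f - monom (lead_coeff f) N"
  have "Lam (laguerre_poly N * r) = 0"
  proof (cases "r = 0")
    case False
    have "degree r \<le> N" unfolding r_def using assms by (intro degree_diff_le) (auto simp: degree_monom_le)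
    moreover have "coeff r N = 0" using assms by (simp add: r_def)
    ultimately have "degree r < N" using False
      by (metis eq_zero_or_degree_less)
    thus ?thesis by (rule Lam_laguerre_eq_0)
  qed auto
  moreover have "f = smult (lead_coeff f) (monom 1 N) + r"
    by (simp add: r_def smult_monom)
  hence "Lam (laguerre_poly N * f) = lead_coeff f * Lam (laguerre_poly N * monom 1 N) + Lam (laguerre_poly N * r)"
    by (metis Lam_add Lam_smult distrib_left mult_smult_right)
  moreover have "lead_coeff f \<noteq> 0" using assms(2) by simp
  ultimately show ?thesis using z by simp
qed

text \<open>\<open>Q\<close> is the sum of delta^m times the m-th derivative of \<open>f\<close>,
  the Neumann series that inverts 1 - delta d/dx. The induction uses Q_f = f + delta Q_(f').\<close>

lemma Lam_antiderivative:
  "\<exists>Q. (\<forall>x. poly Q x = Lam (pcompose f [:x, \<delta>:])) \<and> Q - smult \<delta> (pderiv Q) = f"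
proof (induction "degree f" arbitrary: f rule: less_induct)
  case less
  show ?case
  proof (cases "degree f = 0")
    case True
    then obtain a where "f = [:a:]" by (elim degree_eq_zeroE)
    thus ?thesis by (intro exI[of _ "[:a:]"]) (simp add: pderiv_pCons)
  next
    case False
    then obtain Q where Q: "\<And>x. poly Q x = Lam (pcompose (pderiv f) [:x, \<delta>:])"
        "Q - smult \<delta> (pderiv Q) = pderiv f"
      using less[of "pderiv f"] by (auto simp: degree_pderiv)
    have "Lam (pcompose f [:x, \<delta>:]) = poly f x + \<delta> * poly Q x" for x
      using Lam_pderiv[of "pcompose f [:x, \<delta>:]"]
      by (simp add: pderiv_pcompose pderiv_pCons poly_pcompose Lam_smult Q(1))
    moreover have "f + smult \<delta> Q - smult \<delta> (pderiv (f + smult \<delta> Q)) 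
        = f + smult \<delta> (Q - smult \<delta> (pderiv Q)) - smult \<delta> (pderiv f)"
      by (simp add: pderiv_add pderiv_smult smult_add_right smult_diff_right)
    hence "f + smult \<delta> Q - smult \<delta> (pderiv (f + smult \<delta> Q)) = f"
      by (simp add: Q(2))
    ultimately show ?thesis by (intro exI[of _ "f + smult \<delta> Q"]) simp
  qed
qed

subsection \<open>The oscillatory moment functional\<close>

definition osc :: "real \<Rightarrow> complex poly \<Rightarrow> complex" where
  "osc \<omega> f = exp (- (\<i> * of_real \<omega>)) * Lam (pcompose f [:-1, \<i> / of_real \<omega>:])
           - exp (\<i> * of_real \<omega>) * Lam (pcompose f [:1, \<i> / of_real \<omega>:])"

lemma has_integral_osc:
  assumes "\<omega> \<noteq> 0"
  shows "((\<lambda>x::real. poly f (of_real x) * exp (\<i> * of_real (\<omega> * x))) has_integral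
            (\<i> / of_real \<omega> * osc \<omega> f)) {-1..1}"
proof -
  define \<delta> where "\<delta> = \<i> / complex_of_real \<omega>"
  obtain Q where Q: "\<And>x. poly Q x = Lam (pcompose f [:x, \<delta>:])" "Q - smult \<delta> (pderiv Q) = f"
    using Lam_antiderivative[of f \<delta>] by blast
  \<comment> \<open>By delta i omega = -1, differentiating \<open>G\<close> puts Q - delta Q' in
    front of the exponential, and this is \<open>f\<close>.\<close>
  define G where "G = (\<lambda>z. - \<delta> * poly Q z * exp (\<i> * of_real \<omega> * z))"
  have G: "(G has_field_derivative poly f z * exp (\<i> * of_real \<omega> * z)) (at z)" for z
  proof -
    have "(G has_field_derivative 
       (- \<delta> * poly (pderiv Q) z * exp (\<i> * of_real \<omega> * z) 
         + - \<delta> * poly Q z * (exp (\<i> * of_real \<omega> * z) * (\<i> * of_real \<omega>)))) (at z)"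
      unfolding G_def by (rule derivative_eq_intros refl | simp add: algebra_simps)+
    also have "(- \<delta> * poly (pderiv Q) z * exp (\<i> * of_real \<omega> * z) 
         + - \<delta> * poly Q z * (exp (\<i> * of_real \<omega> * z) * (\<i> * of_real \<omega>)))
       = (poly Q z - \<delta> * poly (pderiv Q) z) * exp (\<i> * of_real \<omega> * z)"
      using assms by (simp add: \<delta>_def field_simps)
    also have "poly Q z - \<delta> * poly (pderiv Q) z = poly f z"
      by (subst Q(2)[symmetric]) simp
    finally show ?thesis .
  qed
  have "((\<lambda>x::real. poly f (of_real x) * exp (\<i> * of_real \<omega> * of_real x)) has_integral
     (G (of_real 1) - G (of_real (-1)))) {-1..1}"
    by (rule fundamental_theorem_of_calculus) 
       (auto intro!: has_vector_derivative_real_field has_field_derivative_at_within G)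
  also have "G (of_real 1) - G (of_real (-1)) = \<i> / of_real \<omega> * osc \<omega> f"
    by (simp add: G_def osc_def Q(1) \<delta>_def algebra_simps diff_divide_distrib)
  finally show ?thesis by (simp add: mult.assoc)
qed

subsection \<open>Polynomial preliminaries\<close>

text \<open>This is the bound of |p'/p| by the sum of 1/|x - a| over the roots a, multiplied out so
  that p(x) = 0 is allowed. One root is split off at a time.\<close>

lemma pderiv_bound_if_roots_far:
  fixes p :: "complex poly"
  assumes "\<And>a. poly p a = 0 \<Longrightarrow> \<rho> \<le> cmod (x - a)" "\<rho> \<ge> 0"
  shows "cmod (poly (pderiv p) x) * \<rho> \<le> degree p * cmod (poly p x)"
  using assms(1)
proof (induction "degree p" arbitrary: p)
  case 0
  then obtain a where "p = [:a:]" by (metis degree_eq_zeroE)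
  thus ?case by (simp add: pderiv_pCons)
next
  case (Suc n)
  have "\<not> constant (poly p)"
    using Suc.hyps(2) by (simp add: constant_degree)
  then obtain a where a: "poly p a = 0"
    using fundamental_theorem_of_algebra by blast
  then obtain q where q: "p = [:-a, 1:] * q"
    by (metis dvdE poly_eq_0_iff_dvd)
  have "q \<noteq> 0" using q Suc.hyps(2) by auto
  hence dq: "degree q = n" using Suc.hyps(2) unfolding q by (subst (asm) degree_mult_eq) auto
  have IH: "cmod (poly (pderiv q) x) * \<rho> \<le> n * cmod (poly q x)"
    using Suc.hyps(1)[of q] Suc.prems dq by (simp add: q)
  have r: "\<rho> \<le> cmod (x - a)" using Suc.prems a by blast
  have "cmod (poly (pderiv p) x) = cmod (poly q x + (x - a) * poly (pderiv q) x)"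
    unfolding q pderiv_mult by (simp add: pderiv_pCons algebra_simps)
  also have "\<dots> \<le> cmod (poly q x) + cmod (x - a) * cmod (poly (pderiv q) x)"
    by (metis norm_mult norm_triangle_ineq)
  finally have "cmod (poly (pderiv p) x) * \<rho> 
    \<le> (cmod (poly q x) + cmod (x - a) * cmod (poly (pderiv q) x)) * \<rho>"
    using assms(2) by (rule mult_right_mono)
  also have "\<dots> = cmod (poly q x) * \<rho> + cmod (x - a) * (cmod (poly (pderiv q) x) * \<rho>)"
    by (simp add: algebra_simps)
  also have "\<dots> \<le> cmod (poly q x) * cmod (x - a) + cmod (x - a) * (n * cmod (poly q x))"
    using r IH by (intro add_mono mult_left_mono) auto
  also have "\<dots> = Suc n * (cmod (x - a) * cmod (poly q x))"
    by (simp add: algebra_simps)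
  also have "cmod (x - a) * cmod (poly q x) = cmod (poly p x)"
    by (simp add: q norm_mult[symmetric] algebra_simps)
  also have "Suc n = degree p" by (rule Suc.hyps(2))
  finally show ?case .
qed

lemma root_near:
  fixes p :: "complex poly"
  assumes "degree p * cmod (poly p x) < cmod (poly (pderiv p) x) * \<rho>" "\<rho> \<ge> 0"
  obtains a where "poly p a = 0" "cmod (a - x) < \<rho>"
  using pderiv_bound_if_roots_far[of p \<rho> x] assms
  by (metis linorder_not_le norm_minus_commute)

text \<open>Linear algebra without bases: imposing one linear condition on a space of polynomials
  removes at most one number from the set of degrees attained.\<close>

lemma exists_poly_in_kernel:
  fixes \<phi> :: "nat \<Rightarrow> complex poly \<Rightarrow> complex"
  assumes lin: "\<And>k f a g. \<phi> k (f - smult a g) = \<phi> k f - a * \<phi> k g"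
  shows "\<exists>q. q \<noteq> 0 \<and> degree q \<le> n \<and> (\<forall>k<n. \<phi> k q = 0)"
proof -
  define V where "V = (\<lambda>k. {q. degree q \<le> n \<and> (\<forall>i<k. \<phi> i q = 0)})"
  \<comment> \<open>Attained degrees replace a basis: \<open>card (D k)\<close> plays the role of
    the dimension of \<open>V k\<close>.\<close>
  define D where "D = (\<lambda>k. degree ` (V k - {0}))"
  have fin: "finite (D k)" for k
    by (rule finite_subset[of _ "{..n}"]) (auto simp: D_def V_def)
  have "n + 1 \<le> card (D k) + k" for k
  proof (induction k)
    case 0
    have "i \<in> D 0" if "i \<le> n" for i
      unfolding D_def V_def using that
      by (intro image_eqI[of _ _ "monom 1 i"]) (auto simp: degree_monom_eq)
    hence "card {..n} \<le> card (D 0)"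
      by (intro card_mono fin) auto
    thus ?case by simp
  next
    case (Suc k)
    have "\<exists>d. D k \<subseteq> insert d (D (Suc k))"
    proof (cases "\<forall>q\<in>V k. \<phi> k q = 0")
      case True
      hence "V k \<subseteq> V (Suc k)" by (auto simp: V_def less_Suc_eq)
      thus ?thesis by (auto simp: D_def)
    next
      case False
      define P where "P = (\<lambda>d. \<exists>q. q \<in> V k \<and> \<phi> k q \<noteq> 0 \<and> degree q = d)"
      \<comment> \<open>Below degree \<open>d\<close> the functional already vanishes; above it a
        multiple of \<open>q\<close> can be subtracted without changing the degree. Hence
        \<open>d\<close> is the only degree that may be lost.\<close>
      define d where "d = (LEAST d. P d)"
      have "\<exists>d. P d" using False unfolding P_def by blast
      hence d: "P d" "\<And>d'. d' < d \<Longrightarrow> \<not> P d'"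
        unfolding d_def by (auto intro: LeastI_ex dest: not_less_Least)
      then obtain q where q: "q \<in> V k" "\<phi> k q \<noteq> 0" "degree q = d" by (auto simp: P_def)
      have "degree f \<in> insert d (D (Suc k))" if f: "f \<in> V k" "f \<noteq> 0" for f
      proof (cases "degree f" d rule: linorder_cases)
        case less
        hence "\<phi> k f = 0" using d(2) f by (auto simp: P_def)
        hence "f \<in> V (Suc k)" using f by (auto simp: V_def less_Suc_eq)
        thus ?thesis using f by (auto simp: D_def)
      next
        case greater
        define f' where "f' = f - smult (\<phi> k f / \<phi> k q) q"
        have "degree (smult (\<phi> k f / \<phi> k q) q) < degree f"
          using greater q(3) by auto
        hence df: "degree f' = degree f"
          unfolding f'_def by (metis degree_add_eq_left degree_minus diff_conv_add_uminus)
        moreover have "f' \<in> V (Suc k)"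
          using f q df by (auto simp: V_def f'_def lin less_Suc_eq)
        moreover have "f' \<noteq> 0" using df greater by auto
        ultimately show ?thesis unfolding D_def
          by (intro insertI2 image_eqI[of _ _ f']) auto
      qed auto
      note key = this
      have "D k \<subseteq> insert d (D (Suc k))"
      proof
        fix e assume "e \<in> D k"
        then obtain f where "f \<in> V k" "f \<noteq> 0" "e = degree f" unfolding D_def by blast
        with key[of f] show "e \<in> insert d (D (Suc k))" by simp
      qed
      thus ?thesis by (rule exI[of _ d])
    qed
    then obtain d where sub: "D k \<subseteq> insert d (D (Suc k))" by blast
    have "card (D k) \<le> card (insert d (D (Suc k)))"
      by (rule card_mono[OF finite.insertI[OF fin] sub])
    also have "\<dots> \<le> Suc (card (D (Suc k)))"
      by (simp add: card_insert_if fin)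
    finally show ?case using Suc.IH by simp
  qed
  from this[of n] have "D n \<noteq> {}" by auto
  then obtain q where "q \<in> V n" "q \<noteq> 0" unfolding D_def by blast
  thus ?thesis unfolding V_def by blast
qed

lemma monic_eq_prod_roots:
  fixes p :: "'a::field poly"
  assumes "finite A" "inj_on z A" "\<And>j. j \<in> A \<Longrightarrow> poly p (z j) = 0" "degree p = card A" "lead_coeff p = 1"
  shows "p = (\<Prod>j\<in>A. [:- z j, 1:])"
proof (rule poly_eqI_degree_lead_coeff[of _ "card A" _ "z ` A"])
  have d: "degree (\<Prod>j\<in>A. [:- z j, 1:]) = card A"
    by (subst degree_prod_sum_eq) auto
  show "coeff p (card A) = coeff (\<Prod>j\<in>A. [:- z j, 1:]) (card A)"
    using assms(4,5) lead_coeff_prod[of "\<lambda>j. [:- z j, 1:]" A] by (simp add: d)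
  show "degree (\<Prod>j\<in>A. [:- z j, 1:]) \<le> card A" using d by simp
  show "card A \<le> card (z ` A)" using assms(2) by (simp add: card_image)
qed (use assms in \<open>auto simp: poly_prod\<close>)

lemma prod_linear_dvd:
  fixes p :: "'a::field poly"
  assumes "finite A" "inj_on z A" "\<And>j. j \<in> A \<Longrightarrow> poly p (z j) = 0"
  shows "(\<Prod>j\<in>A. [:- z j, 1:]) dvd p"
  using assms
proof (induction A arbitrary: p rule: finite_induct)
  case (insert i A)
  then obtain q where q: "p = [:- z i, 1:] * q"
    by (metis dvdE insertI1 poly_eq_0_iff_dvd)
  have "poly q (z j) = 0" if "j \<in> A" for j
    using insert.prems insert.hyps that unfolding q by (auto simp: inj_on_def)
  hence "(\<Prod>j\<in>A. [:- z j, 1:]) dvd q"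
    using insert by (intro insert.IH) auto
  thus ?case using insert.hyps unfolding q prod.insert[OF insert.hyps] by (intro mult_dvd_mono) auto
qed auto

text \<open>The sum of the absolute values of finitely many constants serves all indices at
  once.\<close>

lemma uniform_const:
  fixes f :: "'a \<Rightarrow> 'b \<Rightarrow> real"
  assumes "finite A" "\<And>a. a \<in> A \<Longrightarrow> \<exists>C. \<forall>x\<in>X. f a x \<le> C * g x" "\<And>x. x \<in> X \<Longrightarrow> g x \<ge> 0"
  obtains C where "C \<ge> 0" "\<And>a x. a \<in> A \<Longrightarrow> x \<in> X \<Longrightarrow> f a x \<le> C * g x"
proof -
  obtain D where D: "\<And>a x. a \<in> A \<Longrightarrow> x \<in> X \<Longrightarrow> f a x \<le> D a * g x"
    using assms(2) by metis
  show ?thesis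
  proof (rule that[of "\<Sum>a\<in>A. \<bar>D a\<bar>"])
    fix a x assume ax: "a \<in> A" "x \<in> X"
    have "D a \<le> \<bar>D a\<bar>" by simp
    also have "\<dots> \<le> (\<Sum>a\<in>A. \<bar>D a\<bar>)"
      using ax assms(1) by (intro member_le_sum) auto
    finally have "D a * g x \<le> (\<Sum>a\<in>A. \<bar>D a\<bar>) * g x"
      using assms(3) ax by (intro mult_right_mono) auto
    thus "f a x \<le> (\<Sum>a\<in>A. \<bar>D a\<bar>) * g x" using D[OF ax] by simp
  qed (auto intro: sum_nonneg)
qed

text \<open>Turns s(sigma + delta t) into a polynomial in delta over polynomials in t, the shape to
  which \<open>Lam_poly_limit\<close> applies.\<close>

lemma pcompose_linear_conv_poly:
  "\<exists>F :: complex poly poly. (\<forall>\<delta>. pcompose s [:\<sigma>, \<delta>:] = poly F [:\<delta>:]) \<and> poly F 0 = [:poly s \<sigma>:]"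
proof (induction s)
  case 0
  show ?case by (rule exI[of _ 0]) auto
next
  case (pCons a s)
  then obtain F where F: "\<And>\<delta>. pcompose s [:\<sigma>, \<delta>:] = poly F [:\<delta>:]" "poly F 0 = [:poly s \<sigma>:]"
    by blast
  show ?case
  proof (rule exI[of _ "[:[:a:]:] + [:[:\<sigma>:], [:0, 1:]:] * F"], intro conjI allI)
    fix \<delta> :: complex
    have "pcompose (pCons a s) [:\<sigma>, \<delta>:] = [:a:] + [:\<sigma>, \<delta>:] * poly F [:\<delta>:]"
      by (simp only: pcompose_pCons F(1))
    thus "pcompose (pCons a s) [:\<sigma>, \<delta>:] = poly ([:[:a:]:] + [:[:\<sigma>:], [:0, 1:]:] * F) [:\<delta>:]"
      by simp
    show "poly ([:[:a:]:] + [:[:\<sigma>:], [:0, 1:]:] * F) 0 = [:poly (pCons a s) \<sigma>:]"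
      by (simp add: F(2))
  qed
qed

text \<open>Lets either endpoint be taken as the one of interest. Only the modulus of the two
  oscillating phases matters for the estimates.\<close>

lemma osc_conv:
  assumes "\<sigma> \<in> {1, -1}"
  obtains \<alpha> \<beta> where "cmod \<alpha> = 1" "cmod \<beta> = 1"
    "\<And>f. osc \<omega> f = \<alpha> * Lam (pcompose f [:\<sigma>, \<i> / of_real \<omega>:]) + \<beta> * Lam (pcompose f [:-\<sigma>, \<i> / of_real \<omega>:])"
proof -
  have e: "cmod (exp (\<i> * of_real \<omega>)) = 1" "cmod (exp (- (\<i> * of_real \<omega>))) = 1"
    by auto
  show ?thesis
  proof (cases "\<sigma> = 1")
    case True
    show ?thesis
      by (rule that[of "- exp (\<i> * of_real \<omega>)" "exp (- (\<i> * of_real \<omega>))"]) 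
         (use e True in \<open>auto simp: osc_def\<close>)
  next
    case False
    hence "\<sigma> = -1" using assms by auto
    show ?thesis
      by (rule that[of "exp (- (\<i> * of_real \<omega>))" "- exp (\<i> * of_real \<omega>)"]) 
         (use e \<open>\<sigma> = -1\<close> in \<open>auto simp: osc_def\<close>)
  qed
qed

lemma osc_add: "osc \<omega> (f + g) = osc \<omega> f + osc \<omega> g"
  by (simp add: osc_def pcompose_add Lam_add algebra_simps)

lemma osc_smult: "osc \<omega> (smult a f) = a * osc \<omega> f"
  by (simp add: osc_def pcompose_smult Lam_smult algebra_simps)

lemma osc_diff: "osc \<omega> (f - g) = osc \<omega> f - osc \<omega> g"
  by (simp add: osc_def pcompose_diff Lam_diff algebra_simps)

lemma osc_sum: "osc \<omega> (\<Sum>i\<in>A. f i) = (\<Sum>i\<in>A. osc \<omega> (f i))"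
  by (simp add: osc_def pcompose_sum Lam_sum sum_distrib_left sum_subtractf)

subsection \<open>Expansion at the endpoints\<close>

locale laguerre_nodes =
  fixes N :: nat and c :: "nat \<Rightarrow> real"
  assumes N1: "N \<ge> 1"
    and inj_c: "inj_on c {1..N}"
    and zeros_c: "\<And>k. k \<in> {1..N} \<Longrightarrow> laguerre N (c k) = 0"
begin

definition I :: "nat set" where "I = {1..N}"

lemma finite_I [simp]: "finite I" and card_I [simp]: "card I = N"
  by (simp_all add: I_def)

lemma inj_c_iff: "j \<in> I \<Longrightarrow> k \<in> I \<Longrightarrow> c j = c k \<longleftrightarrow> j = k"
  using inj_on_eq_iff[OF inj_c] by (simp add: I_def)

section \<open>Node polynomials and Gauss-Laguerre quadrature\<close>

definition L :: "nat set \<Rightarrow> complex poly" where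
  "L A = (\<Prod>k\<in>A. [:- of_real (c k), 1:])"

lemma degree_L: "finite A \<Longrightarrow> degree (L A) = card A"
  unfolding L_def by (subst degree_prod_sum_eq) auto

lemma L_nonzero [simp]: "L A \<noteq> 0"
  by (cases "finite A") (auto simp: L_def)

lemma laguerre_poly_eq: "\<exists>a. a \<noteq> 0 \<and> laguerre_poly N = smult a (L I)"
proof (intro exI[of _ "lead_coeff (laguerre_poly N)"] conjI)
  show nz: "lead_coeff (laguerre_poly N) \<noteq> 0"
    by (simp add: degree_laguerre_poly coeff_laguerre_poly)
  have "L I = smult (inverse (lead_coeff (laguerre_poly N))) (laguerre_poly N)"
    unfolding L_def
  proof (rule monic_eq_prod_roots[symmetric, where z = "\<lambda>k. complex_of_real (c k)"])
    show "inj_on (\<lambda>k. complex_of_real (c k)) I"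
      by (auto simp: inj_on_def inj_c_iff)
    show "degree (smult (inverse (lead_coeff (laguerre_poly N))) (laguerre_poly N)) = card I"
      using nz by (simp add: degree_laguerre_poly)
    show "lead_coeff (smult (inverse (lead_coeff (laguerre_poly N))) (laguerre_poly N)) = 1"
      using nz by simp
  qed (auto simp: poly_laguerre_poly zeros_c I_def)
  thus "laguerre_poly N = smult (lead_coeff (laguerre_poly N)) (L I)"
    using nz by simp
qed

lemma Lam_L_eq_0: "degree f < N \<Longrightarrow> Lam (L I * f) = 0"
  using laguerre_poly_eq Lam_laguerre_eq_0[of f N] by (auto simp: Lam_smult)

text \<open>Every node occurs, so \<open>L I\<close> splits off and the cofactor
  \<open>L (A \<inter> B)\<close> has degree |A| + |B| - N < N; orthogonality applies.\<close>

lemma Lam_L_union_eq_0: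
  assumes "A \<union> B = I" "card A + card B < 2 * N"
  shows "Lam (L A * L B) = 0"
proof -
  have fin: "finite A" "finite B" using assms(1) by (metis finite_Un finite_I)+
  have "L A * L B = L I * L (A \<inter> B)"
    unfolding L_def assms(1)[symmetric] using fin by (simp add: prod.union_inter)
  moreover have "card (A \<inter> B) < N"
    using card_Un_Int[OF fin] assms by simp
  ultimately show ?thesis using fin by (simp add: Lam_L_eq_0 degree_L)
qed

text \<open>Gauss quadrature in which a single node survives: dividing \<open>f\<close> by t - c_k
  leaves a quotient of degree below N, to which \<open>L I\<close> is orthogonal.\<close>

lemma Lam_L_minus:
  assumes "k \<in> I" "degree f \<le> N"
  shows "Lam (L (I - {k}) * f) = poly f (of_real (c k)) * Lam (L (I - {k}))"
proof -
  define q where "q = synthetic_div f (of_real (c k))"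
  have f: "f = [:- of_real (c k), 1:] * q + [:poly f (of_real (c k)):]"
    using synthetic_div_correct'[of "of_real (c k)" f] by (simp add: q_def)
  have q: "degree q < N" using assms(2) N1 by (simp add: q_def degree_synthetic_div)
  have LI: "L I = [:- of_real (c k), 1:] * L (I - {k})"
    unfolding L_def using assms(1) by (subst prod.remove[of _ k]) auto
  have "L (I - {k}) * f = L I * q + smult (poly f (of_real (c k))) (L (I - {k}))"
    by (subst (1) f, subst LI) (simp add: algebra_simps)
  thus ?thesis using Lam_L_eq_0[OF q] by (simp add: Lam_add Lam_smult)
qed

text \<open>Testing against the Laguerre polynomial of degree N - 1 gives a nonzero value, which by
  quadrature contains the weight \<open>Lam (L (I - {k}))\<close> as a factor. So the weight is
  nonzero, and so is its product with the value of \<open>L (I - {k})\<close> at c_k.\<close>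

lemma Lam_L_square_neq_0:
  assumes "k \<in> I"
  shows "Lam (L (I - {k}) * L (I - {k})) \<noteq> 0"
proof -
  have d: "degree (L (I - {k})) = N - 1" using assms by (simp add: degree_L)
  have "Lam (L (I - {k}) * laguerre_poly (N - 1)) \<noteq> 0"
    using Lam_laguerre_neq_0[OF d] by (simp add: mult.commute)
  hence "Lam (L (I - {k})) \<noteq> 0"
    using Lam_L_minus[OF assms, of "laguerre_poly (N - 1)"] by (auto simp: degree_laguerre_poly)
  moreover have "poly (L (I - {k})) (of_real (c k)) \<noteq> 0"
    using assms by (auto simp: L_def poly_prod inj_c_iff)
  ultimately show ?thesis using Lam_L_minus[OF assms, of "L (I - {k})"] d by auto
qed

section \<open>Scaling of products of node factors near an endpoint\<close>

definition H :: "complex \<Rightarrow> nat set \<Rightarrow> complex poly poly" where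
  "H \<sigma> A = (\<Prod>k\<in>A. [: [:2 * \<sigma>:], [:- of_real (c k), 1:] :])"

definition V :: "complex \<Rightarrow> complex \<Rightarrow> nat set \<Rightarrow> nat set \<Rightarrow> complex poly" where
  "V \<delta> \<sigma> A B = (\<Prod>k\<in>A. [:- (\<sigma> + \<delta> * of_real (c k)), 1:]) *
               (\<Prod>k\<in>B. [:- (- \<sigma> + \<delta> * of_real (c k)), 1:])"

lemma V_uminus: "V \<delta> (-\<sigma>) A B = V \<delta> \<sigma> B A"
  by (simp add: V_def mult.commute)

text \<open>Under x = sigma + delta t the factor of a node near sigma becomes delta (t - c_k), while
  one near -sigma becomes 2 sigma + delta (t - c_k), a factor of \<open>H\<close>. So each nearby
  node contributes one power of delta.\<close>

lemma V_pcompose: 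
  "pcompose (V \<delta> \<sigma> A B) [:\<sigma>, \<delta>:] = smult (\<delta> ^ card A) (L A * poly (H \<sigma> B) [:\<delta>:])"
proof -
  have 1: "pcompose [:- (\<sigma> + \<delta> * of_real (c k)), 1:] [:\<sigma>, \<delta>:] = smult \<delta> [:- of_real (c k), 1:]" for k
    by (simp add: pcompose_pCons)
  have 2: "pcompose [:- (- \<sigma> + \<delta> * of_real (c k)), 1:] [:\<sigma>, \<delta>:] = 
             poly [: [:2 * \<sigma>:], [:- of_real (c k), 1:] :] [:\<delta>:]" for k
    by (simp add: pcompose_pCons)
  show ?thesis
    unfolding V_def pcompose_mult pcompose_prod 1 2 H_def L_def poly_prod
    by (simp only: prod_smult prod_constant mult_smult_left)
qed

lemma poly_H_0: "poly (H \<sigma> B) 0 = [:(2 * \<sigma>) ^ card B:]"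
  by (simp add: H_def poly_prod poly_const_pow)

text \<open>Counting nearby nodes gives the power of delta; setting delta = 0 in the rest gives the
  leading coefficient. There are two \<open>V\<close> factors because the integrand is a product of
  a part of p and a test function.\<close>

lemma Lam_V_estimate:
  "\<exists>C\<ge>0. \<forall>\<delta>. cmod \<delta> \<le> 1 \<longrightarrow> 
     cmod (Lam (pcompose (s * V \<delta> \<sigma> A1 B1 * V \<delta> \<sigma> A2 B2) [:\<sigma>, \<delta>:])
        - \<delta> ^ (card A1 + card A2) * (poly s \<sigma> * (2 * \<sigma>) ^ (card B1 + card B2) * Lam (L A1 * L A2)))
     \<le> C * cmod \<delta> ^ (card A1 + card A2 + 1)"
proof -
  obtain S where S: "\<And>\<delta>. pcompose s [:\<sigma>, \<delta>:] = poly S [:\<delta>:]" "poly S 0 = [:poly s \<sigma>:]"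
    using pcompose_linear_conv_poly by blast
  define F where "F = S * [:L A1 * L A2:] * H \<sigma> B1 * H \<sigma> B2"
  obtain C where C: "C \<ge> 0" 
    "\<And>\<delta>. cmod \<delta> \<le> 1 \<Longrightarrow> cmod (Lam (poly F [:\<delta>:]) - Lam (poly F 0)) \<le> C * cmod \<delta>"
    using Lam_poly_limit[of F] by blast
  have F0: "Lam (poly F 0) = poly s \<sigma> * (2 * \<sigma>) ^ (card B1 + card B2) * Lam (L A1 * L A2)"
    by (simp add: F_def S poly_H_0 Lam_smult power_add mult_ac)
  have FD: "Lam (pcompose (s * V \<delta> \<sigma> A1 B1 * V \<delta> \<sigma> A2 B2) [:\<sigma>, \<delta>:])
     = \<delta> ^ (card A1 + card A2) * Lam (poly F [:\<delta>:])" for \<delta>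
    by (simp add: pcompose_mult V_pcompose S F_def power_add Lam_smult mult_ac)
  show ?thesis
  proof (intro exI[of _ C] conjI allI impI C(1))
    fix \<delta> :: complex assume "cmod \<delta> \<le> 1"
    from C(2)[OF this] have "cmod \<delta> ^ (card A1 + card A2) * cmod (Lam (poly F [:\<delta>:]) - Lam (poly F 0))
      \<le> cmod \<delta> ^ (card A1 + card A2) * (C * cmod \<delta>)"
      by (intro mult_left_mono) auto
    thus "cmod (Lam (pcompose (s * V \<delta> \<sigma> A1 B1 * V \<delta> \<sigma> A2 B2) [:\<sigma>, \<delta>:])
        - \<delta> ^ (card A1 + card A2) * (poly s \<sigma> * (2 * \<sigma>) ^ (card B1 + card B2) * Lam (L A1 * L A2)))
     \<le> C * cmod \<delta> ^ (card A1 + card A2 + 1)"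
      unfolding FD F0[symmetric] right_diff_distrib[symmetric] norm_mult norm_power
      by (simp add: mult_ac)
  qed
qed

text \<open>The far endpoint is treated by the same expansion with the roles of A and B exchanged,
  and enters only as an error of order |B1| + |B2|. The phase depends on omega and is therefore
  quantified after it.\<close>

lemma osc_V_estimate:
  assumes "\<sigma> \<in> {1, -1}"
  shows "\<exists>C\<ge>0. \<forall>\<omega>\<ge>1. \<exists>\<alpha>. cmod \<alpha> = 1 \<and>
     cmod (osc \<omega> (s * V (\<i> / of_real \<omega>) \<sigma> A1 B1 * V (\<i> / of_real \<omega>) \<sigma> A2 B2)
        - \<alpha> * (\<i> / of_real \<omega>) ^ (card A1 + card A2) * 
            (poly s \<sigma> * (2 * \<sigma>) ^ (card B1 + card B2) * Lam (L A1 * L A2)))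
     \<le> C * ((1 / \<omega>) ^ (card A1 + card A2 + 1) + (1 / \<omega>) ^ (card B1 + card B2))"
proof -
  obtain C1 where C1: "C1 \<ge> 0" "\<And>\<delta>. cmod \<delta> \<le> 1 \<Longrightarrow>
     cmod (Lam (pcompose (s * V \<delta> \<sigma> A1 B1 * V \<delta> \<sigma> A2 B2) [:\<sigma>, \<delta>:])
        - \<delta> ^ (card A1 + card A2) * (poly s \<sigma> * (2 * \<sigma>) ^ (card B1 + card B2) * Lam (L A1 * L A2)))
     \<le> C1 * cmod \<delta> ^ (card A1 + card A2 + 1)"
    using Lam_V_estimate[of s \<sigma> A1 B1 A2 B2] by blast
  define M where "M = poly s (-\<sigma>) * (2 * (-\<sigma>)) ^ (card A1 + card A2) * Lam (L B1 * L B2)"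
  obtain C2 where C2: "C2 \<ge> 0" "\<And>\<delta>. cmod \<delta> \<le> 1 \<Longrightarrow>
     cmod (Lam (pcompose (s * V \<delta> (-\<sigma>) B1 A1 * V \<delta> (-\<sigma>) B2 A2) [:-\<sigma>, \<delta>:])
        - \<delta> ^ (card B1 + card B2) * M)
     \<le> C2 * cmod \<delta> ^ (card B1 + card B2 + 1)"
    using Lam_V_estimate[of s "-\<sigma>" B1 A1 B2 A2] unfolding M_def by blast
  show ?thesis
  \<comment> \<open>\<open>C2 + cmod M\<close> covers both the remainder and the leading term at the
    far endpoint.\<close>
  proof (intro exI[of _ "C1 + (C2 + cmod M)"] conjI allI impI)
    fix \<omega> :: real assume w: "\<omega> \<ge> 1"
    define \<delta> where "\<delta> = \<i> / complex_of_real \<omega>"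
    define f where "f = s * V \<delta> \<sigma> A1 B1 * V \<delta> \<sigma> A2 B2"
    define T where "T = \<delta> ^ (card A1 + card A2) * (poly s \<sigma> * (2 * \<sigma>) ^ (card B1 + card B2) * Lam (L A1 * L A2))"
    have d: "cmod \<delta> = 1 / \<omega>" "cmod \<delta> \<le> 1" using w by (auto simp: \<delta>_def norm_divide)
    obtain \<alpha> \<beta> where ab: "cmod \<alpha> = 1" "cmod \<beta> = 1"
      "\<And>f. osc \<omega> f = \<alpha> * Lam (pcompose f [:\<sigma>, \<delta>:]) + \<beta> * Lam (pcompose f [:-\<sigma>, \<delta>:])"
      using osc_conv[OF assms, of \<omega>] unfolding \<delta>_def by blast
    have 1: "cmod (Lam (pcompose f [:\<sigma>, \<delta>:]) - T) \<le> C1 * (1 / \<omega>) ^ (card A1 + card A2 + 1)"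
      using C1(2)[OF d(2)] unfolding T_def f_def d(1) .
    have "cmod (Lam (pcompose f [:-\<sigma>, \<delta>:]) - \<delta> ^ (card B1 + card B2) * M) 
      \<le> C2 * (1 / \<omega>) ^ (card B1 + card B2 + 1)"
      using C2(2)[OF d(2)] unfolding f_def d(1) V_uminus .
    hence "cmod (Lam (pcompose f [:-\<sigma>, \<delta>:])) \<le> cmod (\<delta> ^ (card B1 + card B2) * M) + 
       C2 * (1 / \<omega>) ^ (card B1 + card B2 + 1)"
      by (smt (verit) norm_triangle_sub)
    also have "cmod (\<delta> ^ (card B1 + card B2) * M) = cmod M * (1 / \<omega>) ^ (card B1 + card B2)"
      by (simp add: norm_mult norm_power d)
    also have "C2 * (1 / \<omega>) ^ (card B1 + card B2 + 1) \<le> C2 * (1 / \<omega>) ^ (card B1 + card B2)"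
      using w C2(1) by (intro mult_left_mono power_decreasing) auto
    finally have 2: "cmod (Lam (pcompose f [:-\<sigma>, \<delta>:])) \<le> (C2 + cmod M) * (1 / \<omega>) ^ (card B1 + card B2)"
      by (simp add: algebra_simps)
    have "osc \<omega> f - \<alpha> * T = \<alpha> * (Lam (pcompose f [:\<sigma>, \<delta>:]) - T) + \<beta> * Lam (pcompose f [:-\<sigma>, \<delta>:])"
      by (simp add: ab algebra_simps)
    also have "cmod \<dots> \<le> cmod (Lam (pcompose f [:\<sigma>, \<delta>:]) - T) + cmod (Lam (pcompose f [:-\<sigma>, \<delta>:]))"
      by (rule norm_triangle_le) (simp add: norm_mult ab)
    also have "\<dots> \<le> C1 * (1 / \<omega>) ^ (card A1 + card A2 + 1) + (C2 + cmod M) * (1 / \<omega>) ^ (card B1 + card B2)"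
      using 1 2 by linarith
    also have "\<dots> \<le> (C1 + (C2 + cmod M)) * (1 / \<omega>) ^ (card A1 + card A2 + 1) 
        + (C1 + (C2 + cmod M)) * (1 / \<omega>) ^ (card B1 + card B2)"
      using w C1(1) C2(1) by (intro add_mono; intro mult_right_mono) simp_all
    finally show "\<exists>\<alpha>. cmod \<alpha> = 1 \<and>
     cmod (osc \<omega> (s * V (\<i> / of_real \<omega>) \<sigma> A1 B1 * V (\<i> / of_real \<omega>) \<sigma> A2 B2)
        - \<alpha> * (\<i> / of_real \<omega>) ^ (card A1 + card A2) * 
            (poly s \<sigma> * (2 * \<sigma>) ^ (card B1 + card B2) * Lam (L A1 * L A2)))
     \<le> (C1 + (C2 + cmod M)) * ((1 / \<omega>) ^ (card A1 + card A2 + 1) + (1 / \<omega>) ^ (card B1 + card B2))"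
      using ab(1) unfolding f_def T_def \<delta>_def
      by (intro exI[of _ \<alpha>]) (simp add: algebra_simps)
  qed (use C1(1) C2(1) in auto)
qed

text \<open>When the two index sets cover \<open>I\<close>, orthogonality kills the leading
  coefficient and the near endpoint gains one power of 1/omega.\<close>

lemma osc_V_small:
  assumes "\<sigma> \<in> {1, -1}" "A1 \<union> A2 = I" "card A1 + card A2 < 2 * N" 
    "n \<le> card A1 + card A2 + 1" "n \<le> card B1 + card B2"
  shows "\<exists>C. \<forall>\<omega>\<in>{1..}. 
     cmod (osc \<omega> (s * V (\<i> / of_real \<omega>) \<sigma> A1 B1 * V (\<i> / of_real \<omega>) \<sigma> A2 B2)) \<le> C * (1 / \<omega>) ^ n"
proof -
  obtain C where C: "C \<ge> 0" "\<And>\<omega>. \<omega> \<ge> 1 \<Longrightarrow> cmod (osc \<omega> (s * V (\<i> / of_real \<omega>) \<sigma> A1 B1 * V (\<i> / of_real \<omega>) \<sigma> A2 B2))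
     \<le> C * ((1 / \<omega>) ^ (card A1 + card A2 + 1) + (1 / \<omega>) ^ (card B1 + card B2))"
    using osc_V_estimate[OF assms(1), of s A1 B1 A2 B2] 
    unfolding Lam_L_union_eq_0[OF assms(2,3)] by auto
  have "cmod (osc \<omega> (s * V (\<i> / of_real \<omega>) \<sigma> A1 B1 * V (\<i> / of_real \<omega>) \<sigma> A2 B2)) \<le> (2 * C) * (1 / \<omega>) ^ n"
    if "\<omega> \<ge> 1" for \<omega>
  proof -
    have "C * ((1 / \<omega>) ^ (card A1 + card A2 + 1) + (1 / \<omega>) ^ (card B1 + card B2))
       \<le> C * ((1 / \<omega>) ^ n + (1 / \<omega>) ^ n)"
      using that C(1) assms(4,5) by (intro mult_left_mono add_mono power_decreasing) auto
    thus ?thesis using C(2)[OF that] by simp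
  qed
  thus ?thesis by (intro exI[of _ "2 * C"]) auto
qed

end

subsection \<open>The Lagrange basis at the predicted zeros\<close>

lemma pderiv_sum: "pderiv (\<Sum>i\<in>A. f i) = (\<Sum>i\<in>A. pderiv (f i))"
  by (induction A rule: infinite_finite_induct) (auto simp: pderiv_add)

context laguerre_nodes
begin

definition dd :: "real \<Rightarrow> complex" where "dd \<omega> = \<i> / of_real \<omega>"

definition J :: "(complex \<times> nat) set" where "J = {1, -1} \<times> I"

definition nd :: "real \<Rightarrow> complex \<times> nat \<Rightarrow> complex" where
  "nd \<omega> j = fst j + dd \<omega> * of_real (c (snd j))"

definition W :: "real \<Rightarrow> complex poly" where "W \<omega> = V (dd \<omega>) 1 I I"

definition E :: "real \<Rightarrow> complex \<times> nat \<Rightarrow> complex poly" where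
  "E \<omega> j = V (dd \<omega>) (fst j) (I - {snd j}) I"

lemma finite_J [simp]: "finite J" and card_J [simp]: "card J = 2 * N"
  by (simp_all add: J_def card_cartesian_product)

lemma J_cases:
  assumes "j \<in> J"
  obtains \<sigma> k where "j = (\<sigma>, k)" "\<sigma> \<in> {1, -1}" "k \<in> I"
  using assms unfolding J_def by blast

lemma norm_dd: "\<omega> \<ge> 1 \<Longrightarrow> cmod (dd \<omega>) = 1 / \<omega>"
  by (simp add: dd_def norm_divide)

lemma Re_nd: "Re (nd \<omega> j) = Re (fst j)"
  by (simp add: nd_def dd_def)

lemma W_eq: "\<sigma> \<in> {1, -1} \<Longrightarrow> W \<omega> = V (dd \<omega>) \<sigma> I I"
  using V_uminus[of "dd \<omega>" 1 I I] by (auto simp: W_def)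

lemma W_E: 
  assumes "j \<in> J"
  shows "W \<omega> = [:- nd \<omega> j, 1:] * E \<omega> j"
proof -
  obtain \<sigma> k where j: "j = (\<sigma>, k)" "\<sigma> \<in> {1, -1}" "k \<in> I"
    using assms by (rule J_cases)
  have "W \<omega> = V (dd \<omega>) \<sigma> I I" using j(2) by (rule W_eq)
  also have "\<dots> = [:- nd \<omega> j, 1:] * V (dd \<omega>) \<sigma> (I - {k}) I"
    unfolding V_def nd_def j(1) prod.remove[OF finite_I j(3)] fst_conv snd_conv
    by (simp only: mult.assoc)
  finally show ?thesis by (simp add: E_def j(1))
qed

lemma degree_V:
  assumes "finite A" "finite B"
  shows "degree (V \<delta> \<sigma> A B) = card A + card B" "lead_coeff (V \<delta> \<sigma> A B) = 1"
proof -
  have d: "degree (\<Prod>k\<in>S. [:- f k, 1:] :: complex poly) = card S" if "finite S" for f and S :: "nat set"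
    by (subst degree_prod_sum_eq) auto
  have nz: "(\<Prod>k\<in>S. [:- f k, 1:] :: complex poly) \<noteq> 0" if "finite S" for f and S :: "nat set"
    using that by auto
  show "degree (V \<delta> \<sigma> A B) = card A + card B"
    unfolding V_def using assms by (subst degree_mult_eq[OF nz nz]) (simp_all only: d)
  show "lead_coeff (V \<delta> \<sigma> A B) = 1"
    unfolding V_def lead_coeff_mult lead_coeff_prod by simp
qed

lemma degree_W [simp]: "degree (W \<omega>) = 2 * N" and lead_coeff_W: "lead_coeff (W \<omega>) = 1"
  using degree_V[of I I] by (auto simp: W_def)

lemma W_nonzero [simp]: "W \<omega> \<noteq> 0"
  using lead_coeff_W[of \<omega>] by auto

lemma degree_E: "j \<in> J \<Longrightarrow> degree (E \<omega> j) = 2 * N - 1"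
  using N1 by (auto simp: E_def degree_V elim!: J_cases)

lemma degree_E_less:
  assumes "j \<in> J"
  shows "degree (E \<omega> j) < 2 * N"
  unfolding degree_E[OF assms] using N1 by linarith

lemma nodes_separated:
  obtains \<eta> where "\<eta> > 0" "\<And>\<omega> i j. \<omega> \<ge> 1 \<Longrightarrow> i \<in> J \<Longrightarrow> j \<in> J \<Longrightarrow> i \<noteq> j \<Longrightarrow>
     \<eta> / \<omega> \<le> cmod (nd \<omega> i - nd \<omega> j)"
proof -
  \<comment> \<open>The 2 is the horizontal distance between nodes at opposite endpoints; it also
    keeps \<open>S\<close> nonempty when N = 1.\<close>
  define S where "S = insert 2 ((\<lambda>(k, m). \<bar>c k - c m\<bar>) ` {(k, m). k \<in> I \<and> m \<in> I \<and> k \<noteq> m})"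
  have "finite {(k, m). k \<in> I \<and> m \<in> I \<and> k \<noteq> m}"
    by (rule finite_subset[of _ "I \<times> I"]) auto
  hence S: "finite S" "S \<noteq> {}" by (auto simp: S_def)
  have pos: "\<forall>x\<in>S. x > 0" by (auto simp: S_def inj_c_iff)
  show ?thesis
  proof (rule that[of "Min S"])
    show "Min S > 0" using S pos by (simp add: Min_gr_iff)
    fix \<omega> :: real and i j
    assume w: "\<omega> \<ge> 1" and ij: "i \<in> J" "j \<in> J" "i \<noteq> j"
    obtain \<sigma> k where i: "i = (\<sigma>, k)" "\<sigma> \<in> {1, -1}" "k \<in> I" using ij(1) by (rule J_cases)
    obtain \<tau> m where j: "j = (\<tau>, m)" "\<tau> \<in> {1, -1}" "m \<in> I" using ij(2) by (rule J_cases)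
    show "Min S / \<omega> \<le> cmod (nd \<omega> i - nd \<omega> j)"
    proof (cases "\<sigma> = \<tau>")
      case True
      hence "k \<noteq> m" using ij(3) i j by auto
      hence "\<bar>c k - c m\<bar> \<in> S" using i j by (auto simp: S_def)
      hence "Min S \<le> \<bar>c k - c m\<bar>" using S by simp
      hence "Min S / \<omega> \<le> \<bar>c k - c m\<bar> / \<omega>" using w by (intro divide_right_mono) auto
      also have "nd \<omega> i - nd \<omega> j = dd \<omega> * of_real (c k - c m)"
        using True by (simp add: nd_def i j algebra_simps)
      hence "\<bar>c k - c m\<bar> / \<omega> = cmod (nd \<omega> i - nd \<omega> j)"
        using w by (simp only: norm_mult norm_dd norm_of_real) simp
      finally show ?thesis .
    next
      case False
      have "Min S \<le> 2" using S by (intro Min_le) (auto simp: S_def)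
      hence "Min S / \<omega> \<le> 2 / 1" using w by (intro frac_le) auto
      also have "2 = \<bar>Re (nd \<omega> i - nd \<omega> j)\<bar>"
        using False i j by (auto simp: Re_nd)
      also have "\<bar>Re (nd \<omega> i - nd \<omega> j)\<bar> \<le> cmod (nd \<omega> i - nd \<omega> j)" by (rule abs_Re_le_cmod)
      finally show ?thesis by simp
    qed
  qed
qed

lemma nd_eq_iff:
  assumes "\<omega> \<ge> 1" "i \<in> J" "j \<in> J"
  shows "nd \<omega> i = nd \<omega> j \<longleftrightarrow> i = j"
proof -
  obtain \<eta> where \<eta>: "\<eta> > 0" "\<And>\<omega> i j. \<omega> \<ge> 1 \<Longrightarrow> i \<in> J \<Longrightarrow> j \<in> J \<Longrightarrow> i \<noteq> j \<Longrightarrow>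
     \<eta> / \<omega> \<le> cmod (nd \<omega> i - nd \<omega> j)"
    using nodes_separated by blast
  have "\<eta> / \<omega> > 0" using \<eta>(1) assms(1) by simp
  thus ?thesis using \<eta>(2)[OF assms] by force
qed

lemma poly_W_nd: "j \<in> J \<Longrightarrow> poly (W \<omega>) (nd \<omega> j) = 0"
  using W_E[of j \<omega>] by simp

lemma poly_W_eq_0D:
  assumes "poly (W \<omega>) x = 0"
  obtains j where "j \<in> J" "x = nd \<omega> j"
proof -
  have "(\<exists>k\<in>I. x = 1 + dd \<omega> * of_real (c k)) \<or> (\<exists>k\<in>I. x = -1 + dd \<omega> * of_real (c k))"
    using assms by (auto simp: W_def V_def poly_prod algebra_simps)
  thus ?thesis
    using that[of "(1, _)"] that[of "(-1, _)"] by (fastforce simp: J_def nd_def)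
qed

lemma poly_E_nd:
  assumes "\<omega> \<ge> 1" "i \<in> J" "j \<in> J" "i \<noteq> j"
  shows "poly (E \<omega> j) (nd \<omega> i) = 0"
  using W_E[OF assms(3), of \<omega>] poly_W_nd[OF assms(2), of \<omega>] nd_eq_iff[OF assms(1-3)] assms(4) by simp

text \<open>Otherwise a nonzero polynomial of degree 2N - 1 would have 2N distinct zeros.\<close>

lemma poly_E_nd_self:
  assumes "\<omega> \<ge> 1" "j \<in> J"
  shows "poly (E \<omega> j) (nd \<omega> j) \<noteq> 0"
proof
  assume z: "poly (E \<omega> j) (nd \<omega> j) = 0"
  have "E \<omega> j = 0"
  proof (rule poly_eqI_degree[of "nd \<omega> ` J"])
    show "poly (E \<omega> j) x = poly 0 x" if "x \<in> nd \<omega> ` J" for x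
      using that z poly_E_nd[OF assms(1) _ assms(2)] by auto
    have "card (nd \<omega> ` J) = 2 * N"
      using nd_eq_iff[OF assms(1)] by (subst card_image) (auto simp: inj_on_def)
    thus "degree (E \<omega> j) < card (nd \<omega> ` J)" "degree (0 :: complex poly) < card (nd \<omega> ` J)"
      using N1 assms(2) by (auto simp: degree_E)
  qed
  thus False using W_E[OF assms(2), of \<omega>] by simp
qed

text \<open>Lagrange interpolation recovers the remainder modulo \<open>W\<close>, whose degree is
  below the number 2N of nodes.\<close>

lemma lagrange_decomposition:
  assumes "\<omega> \<ge> 1"
  shows "p = p div W \<omega> * W \<omega> + 
     (\<Sum>j\<in>J. smult (poly (p mod W \<omega>) (nd \<omega> j) / poly (E \<omega> j) (nd \<omega> j)) (E \<omega> j))"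
proof -
  let ?r = "p mod W \<omega>"
  have "?r = (\<Sum>j\<in>J. smult (poly ?r (nd \<omega> j) / poly (E \<omega> j) (nd \<omega> j)) (E \<omega> j))"
  proof (rule poly_eqI_degree[of "nd \<omega> ` J"])
    have c: "card (nd \<omega> ` J) = 2 * N"
      using nd_eq_iff[OF assms(1)] by (subst card_image) (auto simp: inj_on_def)
    show "degree ?r < card (nd \<omega> ` J)"
      using degree_mod_less'[of "W \<omega>" p] N1 by (cases "?r = 0") (auto simp: c)
    have "degree (\<Sum>j\<in>J. smult (poly ?r (nd \<omega> j) / poly (E \<omega> j) (nd \<omega> j)) (E \<omega> j)) \<le> 2 * N - 1"
      by (rule degree_sum_le) (auto simp: degree_E intro: order_trans[OF degree_smult_le])
    thus "degree (\<Sum>j\<in>J. smult (poly ?r (nd \<omega> j) / poly (E \<omega> j) (nd \<omega> j)) (E \<omega> j)) < card (nd \<omega> ` J)"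
      using N1 by (simp add: c)
    fix x assume "x \<in> nd \<omega> ` J"
    then obtain i where i: "i \<in> J" "x = nd \<omega> i" by blast
    have "(\<Sum>j\<in>J. poly ?r (nd \<omega> j) / poly (E \<omega> j) (nd \<omega> j) * poly (E \<omega> j) x)
        = (\<Sum>j\<in>{i}. poly ?r (nd \<omega> j) / poly (E \<omega> j) (nd \<omega> j) * poly (E \<omega> j) x)"
      using i poly_E_nd[OF assms i(1)] by (intro sum.mono_neutral_right) auto
    thus "poly ?r x = poly (\<Sum>j\<in>J. smult (poly ?r (nd \<omega> j) / poly (E \<omega> j) (nd \<omega> j)) (E \<omega> j)) x"
      using poly_E_nd_self[OF assms i(1)] by (simp add: poly_sum i(2))
  qed
  thus ?thesis using div_mult_mod_eq[of p "W \<omega>"] by simp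
qed

text \<open>At the same endpoint the two omitted nodes differ, so the factors together cover
  \<open>I\<close> and the order rises from 2N-2 to 2N-1. At opposite endpoints one index set is
  already all of \<open>I\<close>, and each endpoint has 2N-1 nearby factors.\<close>

lemma osc_E_offdiag:
  assumes "i \<in> J" "j \<in> J" "i \<noteq> j"
  shows "\<exists>C. \<forall>\<omega>\<in>{1..}. cmod (osc \<omega> (E \<omega> i * E \<omega> j)) \<le> C * (1 / \<omega>) ^ (2 * N - 1)"
proof -
  obtain \<sigma> k where i: "i = (\<sigma>, k)" "\<sigma> \<in> {1, -1}" "k \<in> I" using assms(1) by (rule J_cases)
  obtain \<tau> m where j: "j = (\<tau>, m)" "\<tau> \<in> {1, -1}" "m \<in> I" using assms(2) by (rule J_cases)
  show ?thesis
  proof (cases "\<sigma> = \<tau>")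
    case True
    hence "(I - {k}) \<union> (I - {m}) = I" using assms(3) i j by auto
    from osc_V_small[OF i(2) this, of "2 * N - 1" I I 1] show ?thesis
      using N1 i j True by (simp add: E_def dd_def)
  next
    case False
    hence t: "\<tau> = - \<sigma>" using i j by auto
    have "(I - {k}) \<union> I = I" by auto
    from osc_V_small[OF i(2) this, of "2 * N - 1" I "I - {m}" 1] show ?thesis
      using N1 i j t by (simp add: E_def dd_def V_uminus)
  qed
qed

text \<open>The near endpoint has 2N-1 factors and gains one order from orthogonality; the far
  endpoint has 2N factors.\<close>

lemma osc_W_E:
  assumes "i \<in> J"
  shows "\<exists>C. \<forall>\<omega>\<in>{1..}. cmod (osc \<omega> (s * W \<omega> * E \<omega> i)) \<le> C * (1 / \<omega>) ^ (2 * N)"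
proof -
  obtain \<sigma> k where i: "i = (\<sigma>, k)" "\<sigma> \<in> {1, -1}" "k \<in> I" using assms(1) by (rule J_cases)
  have "I \<union> (I - {k}) = I" by auto
  from osc_V_small[OF i(2) this, of "2 * N" I I s] show ?thesis
    using N1 i by (simp add: E_def dd_def W_eq[OF i(2)])
qed

lemma osc_W_E_uniform:
  obtains C where "C \<ge> 0" "\<And>i \<omega>. i \<in> J \<Longrightarrow> \<omega> \<ge> 1 \<Longrightarrow> 
     cmod (osc \<omega> (s * W \<omega> * E \<omega> i)) \<le> C * (1 / \<omega>) ^ (2 * N)"
proof (rule uniform_const[OF finite_J, where X = "{1..}" and f = "\<lambda>i \<omega>. cmod (osc \<omega> (s * W \<omega> * E \<omega> i))"
          and g = "\<lambda>\<omega>. (1 / \<omega>) ^ (2 * N)"])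
  show "\<exists>C. \<forall>\<omega>\<in>{1..}. cmod (osc \<omega> (s * W \<omega> * E \<omega> i)) \<le> C * (1 / \<omega>) ^ (2 * N)" if "i \<in> J" for i
    using that by (rule osc_W_E)
qed (use that in auto)

lemma osc_E_diag:
  obtains d C where "d > 0" "C \<ge> 0" "\<And>\<omega> i. \<omega> \<ge> 1 \<Longrightarrow> i \<in> J \<Longrightarrow> 
    d * (1 / \<omega>) ^ (2 * N - 2) - C * (1 / \<omega>) ^ (2 * N - 1) \<le> cmod (osc \<omega> (E \<omega> i * E \<omega> i))"
proof -
  define G where "G = (\<lambda>k. Lam (L (I - {k}) * L (I - {k})))"
  \<comment> \<open>The true leading constants also carry the factor 2^(2N), which is at least 1 and
    is dropped.\<close>
  define d where "d = Min ((\<lambda>k. cmod (G k)) ` I)"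
  have I: "I \<noteq> {}" using N1 card_I by force
  have d: "d > 0"
    unfolding d_def using I by (subst Min_gr_iff) (auto simp: G_def Lam_L_square_neq_0)
  \<comment> \<open>The lower bound is stated as an upper bound on a difference, so that
    \<open>uniform_const\<close> can supply one constant for all \<open>i\<close>.\<close>
  have *: "\<exists>C. \<forall>\<omega>\<in>{1..}. d * (1 / \<omega>) ^ (2 * N - 2) - cmod (osc \<omega> (E \<omega> i * E \<omega> i)) 
    \<le> C * (1 / \<omega>) ^ (2 * N - 1)" if J: "i \<in> J" for i
  proof -
    obtain \<sigma> k where i: "i = (\<sigma>, k)" "\<sigma> \<in> {1, -1}" "k \<in> I" using J by (rule J_cases)
    have cd: "card (I - {k}) + card (I - {k}) = 2 * N - 2" using i(3) by simp
    have c2: "card I + card I = 2 * N" by simp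
    obtain C where C: "C \<ge> 0" "\<And>\<omega>. \<omega> \<ge> 1 \<Longrightarrow> \<exists>\<alpha>. cmod \<alpha> = 1 \<and>
     cmod (osc \<omega> (E \<omega> i * E \<omega> i)
        - \<alpha> * dd \<omega> ^ (2 * N - 2) * ((2 * \<sigma>) ^ (2 * N) * G k))
     \<le> C * ((1 / \<omega>) ^ (2 * N - 2 + 1) + (1 / \<omega>) ^ (2 * N))"
      using osc_V_estimate[OF i(2), of 1 "I - {k}" I "I - {k}" I, unfolded cd c2 poly_1 mult_1_left]
      unfolding E_def dd_def G_def i(1) fst_conv snd_conv by blast
    have "d * (1 / \<omega>) ^ (2 * N - 2) - cmod (osc \<omega> (E \<omega> i * E \<omega> i)) \<le> (2 * C) * (1 / \<omega>) ^ (2 * N - 1)"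
      if w: "\<omega> \<ge> 1" for \<omega>
    proof -
      obtain \<alpha> where a: "cmod \<alpha> = 1" "cmod (osc \<omega> (E \<omega> i * E \<omega> i)
          - \<alpha> * dd \<omega> ^ (2 * N - 2) * ((2 * \<sigma>) ^ (2 * N) * G k))
         \<le> C * ((1 / \<omega>) ^ (2 * N - 2 + 1) + (1 / \<omega>) ^ (2 * N))"
        using C(2)[OF w] by blast
      have "d * 1 \<le> cmod (G k) * 2 ^ (2 * N)"
        unfolding d_def using i(3) by (intro mult_mono Min_le) auto
      hence "d * (1 / \<omega>) ^ (2 * N - 2) \<le> (cmod (G k) * 2 ^ (2 * N)) * (1 / \<omega>) ^ (2 * N - 2)"
        using w by (intro mult_right_mono) auto
      also have "\<dots> = cmod (\<alpha> * dd \<omega> ^ (2 * N - 2) * ((2 * \<sigma>) ^ (2 * N) * G k))"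
        using i(2) by (auto simp: norm_mult norm_power a norm_dd[OF w])
      also have "\<dots> \<le> cmod (osc \<omega> (E \<omega> i * E \<omega> i)) + cmod (osc \<omega> (E \<omega> i * E \<omega> i)
          - \<alpha> * dd \<omega> ^ (2 * N - 2) * ((2 * \<sigma>) ^ (2 * N) * G k))"
        by (metis norm_minus_commute norm_triangle_sub)
      also note a(2)
      also have "C * ((1 / \<omega>) ^ (2 * N - 2 + 1) + (1 / \<omega>) ^ (2 * N)) 
         \<le> C * ((1 / \<omega>) ^ (2 * N - 1) + (1 / \<omega>) ^ (2 * N - 1))"
        using w C(1) N1 by (intro mult_left_mono add_mono power_decreasing) auto
      finally show ?thesis by (simp add: algebra_simps)
    qed
    thus ?thesis by (intro exI[of _ "2 * C"]) auto
  qed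
  obtain C where C: "C \<ge> 0" "\<And>i \<omega>. i \<in> J \<Longrightarrow> \<omega> \<in> {1..} \<Longrightarrow> 
     d * (1 / \<omega>) ^ (2 * N - 2) - cmod (osc \<omega> (E \<omega> i * E \<omega> i)) \<le> C * (1 / \<omega>) ^ (2 * N - 1)"
    by (rule uniform_const[OF finite_J, where X = "{1..}" and 
          f = "\<lambda>i \<omega>. d * (1 / \<omega>) ^ (2 * N - 2) - cmod (osc \<omega> (E \<omega> i * E \<omega> i))"
          and g = "\<lambda>\<omega>. (1 / \<omega>) ^ (2 * N - 1)"]) (use * in auto)
  show ?thesis
  proof (rule that[OF d C(1)])
    fix \<omega> :: real and i assume "1 \<le> \<omega>" "i \<in> J"
    thus "d * (1 / \<omega>) ^ (2 * N - 2) - C * (1 / \<omega>) ^ (2 * N - 1) \<le> cmod (osc \<omega> (E \<omega> i * E \<omega> i))"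
      using C(2)[of i \<omega>] by simp
  qed
qed

text \<open>The Gram matrix of the Lagrange basis is diagonally dominant for large \<open>\<omega>\<close>, because
  Gauss-Laguerre quadrature makes its leading part diagonal.\<close>

lemma coefficient_bound:
  obtains C \<omega>0 where "C \<ge> 0" "\<omega>0 \<ge> 1"
    "\<And>\<omega> a b u j. \<omega> \<ge> \<omega>0 \<Longrightarrow> 
       (\<And>i. i \<in> J \<Longrightarrow> osc \<omega> (([:b, a:] * W \<omega> + (\<Sum>j\<in>J. smult (u j) (E \<omega> j))) * E \<omega> i) = 0) \<Longrightarrow>
       j \<in> J \<Longrightarrow> cmod (u j) \<le> C * (cmod a + cmod b) / \<omega>\<^sup>2"
proof -
  obtain d Cd where d: "d > 0" "Cd \<ge> 0" "\<And>\<omega> i. \<omega> \<ge> 1 \<Longrightarrow> i \<in> J \<Longrightarrow> 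
    d * (1 / \<omega>) ^ (2 * N - 2) - Cd * (1 / \<omega>) ^ (2 * N - 1) \<le> cmod (osc \<omega> (E \<omega> i * E \<omega> i))"
    using osc_E_diag by blast
  obtain Co where Co: "Co \<ge> 0" "\<And>i j \<omega>. i \<in> J \<Longrightarrow> j \<in> J \<Longrightarrow> i \<noteq> j \<Longrightarrow> \<omega> \<ge> 1 \<Longrightarrow> 
     cmod (osc \<omega> (E \<omega> i * E \<omega> j)) \<le> Co * (1 / \<omega>) ^ (2 * N - 1)"
  proof -
    have fin: "finite {p \<in> J \<times> J. fst p \<noteq> snd p}" by simp
    show ?thesis
    proof (rule uniform_const[OF fin, where X = "{1..}" and f = "\<lambda>p \<omega>. cmod (osc \<omega> (E \<omega> (fst p) * E \<omega> (snd p)))"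
          and g = "\<lambda>\<omega>. (1 / \<omega>) ^ (2 * N - 1)"])
      fix C assume C: "C \<ge> 0" "\<And>p \<omega>. p \<in> {p \<in> J \<times> J. fst p \<noteq> snd p} \<Longrightarrow> \<omega> \<in> {1..} \<Longrightarrow>
         cmod (osc \<omega> (E \<omega> (fst p) * E \<omega> (snd p))) \<le> C * (1 / \<omega>) ^ (2 * N - 1)"
      show thesis using C(2)[of "(_, _)"] by (intro that[OF C(1)]) auto
    qed (use osc_E_offdiag in auto)
  qed
  obtain C1 where C1: "C1 \<ge> 0" "\<And>i \<omega>. i \<in> J \<Longrightarrow> \<omega> \<ge> 1 \<Longrightarrow> 
     cmod (osc \<omega> (1 * W \<omega> * E \<omega> i)) \<le> C1 * (1 / \<omega>) ^ (2 * N)"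
    using osc_W_E_uniform by blast
  obtain C2 where C2: "C2 \<ge> 0" "\<And>i \<omega>. i \<in> J \<Longrightarrow> \<omega> \<ge> 1 \<Longrightarrow> 
     cmod (osc \<omega> ([:0, 1:] * W \<omega> * E \<omega> i)) \<le> C2 * (1 / \<omega>) ^ (2 * N)"
    using osc_W_E_uniform by blast
  \<comment> \<open>\<open>D\<close> collects everything one power of 1/omega below the diagonal:
    the error of the diagonal itself and at most 2N off-diagonal entries. From omega >= 2 D / d on,
    it uses up at most half of \<open>d\<close>.\<close>
  define D where "D = Cd + 2 * N * Co"
  have D: "D \<ge> 0" using d Co by (simp add: D_def)
  define \<omega>0 where "\<omega>0 = max 1 (2 * D / d)"
  show ?thesis
  proof (rule that[of "2 * (C1 + C2) / d" \<omega>0])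
    show "2 * (C1 + C2) / d \<ge> 0" using C1 C2 d by simp
    show "\<omega>0 \<ge> 1" by (simp add: \<omega>0_def)
    fix \<omega> a b u j
    assume w0: "\<omega> \<ge> \<omega>0" and j: "j \<in> J" and orth: 
      "\<And>i. i \<in> J \<Longrightarrow> osc \<omega> (([:b, a:] * W \<omega> + (\<Sum>j\<in>J. smult (u j) (E \<omega> j))) * E \<omega> i) = 0"
    have w: "\<omega> \<ge> 1" using w0 by (simp add: \<omega>0_def)
    have wD: "D / \<omega> \<le> d / 2"
    proof -
      have "2 * D / d \<le> \<omega>" using w0 by (simp add: \<omega>0_def)
      thus ?thesis using w d(1) by (simp add: field_simps)
    qed
    define K where "K = cmod a + cmod b"
    define \<epsilon> where "\<epsilon> = 1 / \<omega>"
    have e: "\<epsilon> > 0" using w by (simp add: \<epsilon>_def)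
    \<comment> \<open>Diagonal dominance in the maximum norm: the row \<open>i\<close> is taken
      where |u_i| is largest, so all other coefficients are bounded by \<open>M\<close>.\<close>
    define M where "M = Max ((\<lambda>j. cmod (u j)) ` J)"
    have M: "cmod (u j) \<le> M" if "j \<in> J" for j
      unfolding M_def using that by simp
    have "M \<in> (\<lambda>j. cmod (u j)) ` J" unfolding M_def using j by (intro Max_in) auto
    then obtain i where i: "i \<in> J" "cmod (u i) = M" by auto
    have M0: "M \<ge> 0" using i by (metis norm_ge_zero)
    have "([:b, a:] * W \<omega> + (\<Sum>j\<in>J. smult (u j) (E \<omega> j))) * E \<omega> i
       = smult b (1 * W \<omega> * E \<omega> i) + smult a ([:0, 1:] * W \<omega> * E \<omega> i) 
         + (\<Sum>j\<in>J. smult (u j) (E \<omega> j * E \<omega> i))"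
      by (simp add: algebra_simps sum_distrib_left)
    also have "(\<Sum>j\<in>J. smult (u j) (E \<omega> j * E \<omega> i)) = smult (u i) (E \<omega> i * E \<omega> i) 
       + (\<Sum>j\<in>J - {i}. smult (u j) (E \<omega> j * E \<omega> i))"
      using i(1) by (subst sum.remove[of _ i]) auto
    finally have "0 = b * osc \<omega> (1 * W \<omega> * E \<omega> i) + a * osc \<omega> ([:0, 1:] * W \<omega> * E \<omega> i)
       + (u i * osc \<omega> (E \<omega> i * E \<omega> i) + (\<Sum>j\<in>J - {i}. u j * osc \<omega> (E \<omega> j * E \<omega> i)))"
      using orth[OF i(1)] by (simp only: osc_add osc_smult osc_sum)
    hence "u i * osc \<omega> (E \<omega> i * E \<omega> i) = - (b * osc \<omega> (1 * W \<omega> * E \<omega> i) + a * osc \<omega> ([:0, 1:] * W \<omega> * E \<omega> i)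
       + (\<Sum>j\<in>J - {i}. u j * osc \<omega> (E \<omega> j * E \<omega> i)))"
      by (simp add: eq_neg_iff_add_eq_0 algebra_simps)
    hence "cmod (u i * osc \<omega> (E \<omega> i * E \<omega> i)) = cmod (b * osc \<omega> (1 * W \<omega> * E \<omega> i) + a * osc \<omega> ([:0, 1:] * W \<omega> * E \<omega> i)
       + (\<Sum>j\<in>J - {i}. u j * osc \<omega> (E \<omega> j * E \<omega> i)))"
      by (simp only: norm_minus_cancel)
    also have "\<dots> \<le> cmod b * (C1 * \<epsilon> ^ (2 * N)) + cmod a * (C2 * \<epsilon> ^ (2 * N))
       + (\<Sum>j\<in>J - {i}. M * (Co * \<epsilon> ^ (2 * N - 1)))"
      using C1(2)[OF i(1), of \<omega>] C2(2)[OF i(1), of \<omega>] Co(2)[OF _ i(1) _ w] w M M0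
      unfolding \<epsilon>_def
      by (intro norm_triangle_mono sum_norm_le) (auto simp: norm_mult intro!: mult_mono)
    also have "(\<Sum>j\<in>J - {i}. M * (Co * \<epsilon> ^ (2 * N - 1))) \<le> (\<Sum>j\<in>J. M * (Co * \<epsilon> ^ (2 * N - 1)))"
      using M0 Co(1) e by (intro sum_mono2) auto
    also have "\<dots> = 2 * N * Co * M * \<epsilon> ^ (2 * N - 1)" by simp
    also have "cmod b * (C1 * \<epsilon> ^ (2 * N)) + cmod a * (C2 * \<epsilon> ^ (2 * N)) \<le> 
        cmod b * ((C1 + C2) * \<epsilon> ^ (2 * N)) + cmod a * ((C1 + C2) * \<epsilon> ^ (2 * N))"
      using C1(1) C2(1) e by (intro add_mono mult_left_mono mult_right_mono) auto
    also have "\<dots> = (C1 + C2) * K * \<epsilon> ^ (2 * N)" by (simp add: K_def algebra_simps)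
    finally have up: "cmod (u i * osc \<omega> (E \<omega> i * E \<omega> i)) \<le> 
        (C1 + C2) * K * \<epsilon> ^ (2 * N) + 2 * N * Co * M * \<epsilon> ^ (2 * N - 1)" by simp
    have low: "M * (d * \<epsilon> ^ (2 * N - 2) - Cd * \<epsilon> ^ (2 * N - 1)) \<le> cmod (u i * osc \<omega> (E \<omega> i * E \<omega> i))"
      unfolding norm_mult i(2) \<epsilon>_def by (rule mult_left_mono[OF d(3)[OF w i(1)] M0])
    have n: "2 * N = 2 + (2 * N - 2)" "2 * N - 1 = Suc (2 * N - 2)" using N1 by arith+
    from low up have "M * (d * \<epsilon> ^ (2 * N - 2)) \<le> (C1 + C2) * K * \<epsilon> ^ (2 * N) + D * M * \<epsilon> ^ (2 * N - 1)"
      by (simp add: D_def algebra_simps)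
    also have "\<epsilon> ^ (2 * N) = \<epsilon>\<^sup>2 * \<epsilon> ^ (2 * N - 2)"
      by (metis n(1) power_add)
    also have "\<epsilon> ^ (2 * N - 1) = \<epsilon> * \<epsilon> ^ (2 * N - 2)"
      by (metis n(2) power_Suc)
    finally have "\<epsilon> ^ (2 * N - 2) * (M * d) \<le> \<epsilon> ^ (2 * N - 2) * ((C1 + C2) * K * \<epsilon>\<^sup>2 + D * M * \<epsilon>)"
      by (simp add: algebra_simps)
    \<comment> \<open>After cancelling the common power, the diagonal has order 0 and the
      inhomogeneous term order omega^(-2); the remaining term is absorbed into the left
      side.\<close>
    hence "M * d \<le> (C1 + C2) * K * \<epsilon>\<^sup>2 + M * (D * \<epsilon>)"
      using e by (simp add: mult_le_cancel_left mult_ac)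
    also have "D * \<epsilon> \<le> d / 2" using wD by (simp add: \<epsilon>_def)
    hence "M * (D * \<epsilon>) \<le> M * (d / 2)" using M0 by (rule mult_left_mono)
    finally have "M * (d / 2) \<le> (C1 + C2) * K * \<epsilon>\<^sup>2" by simp
    hence "M \<le> 2 / d * ((C1 + C2) * K * \<epsilon>\<^sup>2)"
      using d(1) by (simp add: field_simps)
    also have "\<dots> = 2 * (C1 + C2) / d * K / \<omega>\<^sup>2"
      by (simp add: \<epsilon>_def power_one_over)
    finally have "M \<le> 2 * (C1 + C2) / d * K / \<omega>\<^sup>2" .
    thus "cmod (u j) \<le> 2 * (C1 + C2) / d * (cmod a + cmod b) / \<omega>\<^sup>2"
      using M[OF j] unfolding K_def by linarith
  qed
qed

section \<open>Derivatives at the nodes and location of the zeros\<close>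

lemma pderiv_W_nd:
  assumes "i \<in> J"
  shows "poly (pderiv (W \<omega>)) (nd \<omega> i) = poly (E \<omega> i) (nd \<omega> i)"
  unfolding W_E[OF assms] pderiv_mult by (simp add: pderiv_pCons)

text \<open>For equal indices the zeros of E_i are the other nodes, at distance at least eta/omega,
  so the logarithmic derivative bound applies. For distinct ones, differentiating W = (x - x_j) E_j
  at x_i gives E_i(x_i) = (x_i - x_j) E_j'(x_i).\<close>

lemma pderiv_E_bound:
  assumes "\<omega> \<ge> 1" "i \<in> J" "j \<in> J" "\<eta> > 0"
    "\<And>i j. i \<in> J \<Longrightarrow> j \<in> J \<Longrightarrow> i \<noteq> j \<Longrightarrow> \<eta> / \<omega> \<le> cmod (nd \<omega> i - nd \<omega> j)"
  shows "cmod (poly (pderiv (E \<omega> j)) (nd \<omega> i)) * (\<eta> / \<omega>) \<le> 2 * N * cmod (poly (E \<omega> i) (nd \<omega> i))"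
proof (cases "i = j")
  case True
  have "cmod (poly (pderiv (E \<omega> i)) (nd \<omega> i)) * (\<eta> / \<omega>) \<le> degree (E \<omega> i) * cmod (poly (E \<omega> i) (nd \<omega> i))"
  proof (rule pderiv_bound_if_roots_far)
    fix a assume a: "poly (E \<omega> i) a = 0"
    hence "poly (W \<omega>) a = 0" using W_E[OF assms(2), of \<omega>] by simp
    then obtain m where m: "m \<in> J" "a = nd \<omega> m" by (rule poly_W_eq_0D)
    with a poly_E_nd_self[OF assms(1,2)] have "i \<noteq> m" by auto
    thus "\<eta> / \<omega> \<le> cmod (nd \<omega> i - a)" using assms(5)[OF assms(2) m(1)] m(2) by simp
  qed (use assms in auto)
  also have "\<dots> \<le> 2 * N * cmod (poly (E \<omega> i) (nd \<omega> i))"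
  proof (rule mult_right_mono)
    show "real (degree (E \<omega> i)) \<le> real (2 * N)"
      by (subst of_nat_le_iff) (simp add: degree_E assms(2))
  qed simp
  finally show ?thesis using True by simp
next
  case False
  have "poly (E \<omega> i) (nd \<omega> i) = poly (pderiv (W \<omega>)) (nd \<omega> i)" by (rule pderiv_W_nd[OF assms(2), symmetric])
  also have "\<dots> = (nd \<omega> i - nd \<omega> j) * poly (pderiv (E \<omega> j)) (nd \<omega> i)"
    unfolding W_E[OF assms(3)] pderiv_mult using poly_E_nd[OF assms(1-3) False]
    by (simp add: pderiv_pCons algebra_simps)
  finally have *: "cmod (poly (E \<omega> i) (nd \<omega> i)) = 
     cmod (nd \<omega> i - nd \<omega> j) * cmod (poly (pderiv (E \<omega> j)) (nd \<omega> i))" by (simp add: norm_mult)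
  have "cmod (poly (pderiv (E \<omega> j)) (nd \<omega> i)) * (\<eta> / \<omega>) \<le> 
        cmod (poly (pderiv (E \<omega> j)) (nd \<omega> i)) * cmod (nd \<omega> i - nd \<omega> j)"
    using assms(5)[OF assms(2,3) False] by (intro mult_left_mono) auto
  also have "\<dots> = 1 * cmod (poly (E \<omega> i) (nd \<omega> i))" by (simp add: * mult.commute)
  also have "\<dots> \<le> 2 * N * cmod (poly (E \<omega> i) (nd \<omega> i))"
    using N1 by (intro mult_right_mono) auto
  finally show ?thesis .
qed

text \<open>At a node, p reduces to u_i E_i(x_i), with u_i of order omega^(-2), whereas p' is s(x_i)
  E_i(x_i) up to a relative O(1/omega). The lower bound on s(x_i) then gives |p/p'| =
  O(omega^(-2)).\<close>

lemma roots_near_nodes: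
  obtains C \<omega>0 where "C \<ge> 0" "\<omega>0 \<ge> 1"
    "\<And>\<omega> p a b i. \<omega> \<ge> \<omega>0 \<Longrightarrow> p div W \<omega> = [:b, a:] \<Longrightarrow> degree p \<le> 2 * N + 1 \<Longrightarrow>
      (\<And>i. i \<in> J \<Longrightarrow> osc \<omega> (p * E \<omega> i) = 0) \<Longrightarrow> cmod a + cmod b > 0 \<Longrightarrow>
      (cmod a + cmod b) / 4 \<le> cmod (poly [:b, a:] (nd \<omega> i)) \<Longrightarrow> i \<in> J \<Longrightarrow>
      \<exists>z. poly p z = 0 \<and> cmod (z - nd \<omega> i) \<le> C / \<omega>\<^sup>2"
proof -
  obtain C1 \<omega>1 where C1: "C1 \<ge> 0" "\<omega>1 \<ge> 1"
    "\<And>\<omega> a b u j. \<omega> \<ge> \<omega>1 \<Longrightarrow> 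
       (\<And>i. i \<in> J \<Longrightarrow> osc \<omega> (([:b, a:] * W \<omega> + (\<Sum>j\<in>J. smult (u j) (E \<omega> j))) * E \<omega> i) = 0) \<Longrightarrow>
       j \<in> J \<Longrightarrow> cmod (u j) \<le> C1 * (cmod a + cmod b) / \<omega>\<^sup>2"
    using coefficient_bound by blast
  obtain \<eta> where \<eta>: "\<eta> > 0" "\<And>\<omega> i j. \<omega> \<ge> 1 \<Longrightarrow> i \<in> J \<Longrightarrow> j \<in> J \<Longrightarrow> i \<noteq> j \<Longrightarrow>
     \<eta> / \<omega> \<le> cmod (nd \<omega> i - nd \<omega> j)"
    using nodes_separated by blast
  \<comment> \<open>2N summands, each at most C1 K / omega^2 times 2N e omega / eta, add up to
    (B/omega) K e. For omega >= 8 B this is at most K e / 8, half of the lower bound K e / 4 for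
    |s(x_i) E_i(x_i)|.\<close>
  define B where "B = 2 * N * C1 * (2 * N) / \<eta>"
  define \<omega>0 where "\<omega>0 = max \<omega>1 (8 * B)"
  define R where "R = real (2 * N + 1)"
  have R: "R \<ge> 0" by (simp add: R_def)
  \<comment> \<open>\<open>R\<close> bounds the degree, the 8 comes from |p'| >= K e / 8, and the
    added 1 makes the final inequality strict even if \<open>C1\<close> is 0.\<close>
  define C where "C = 8 * (R * C1) + 1"
  show ?thesis
  proof (rule that[of C \<omega>0])
    show "C \<ge> 0" using C1(1) R by (simp add: C_def)
    show "\<omega>0 \<ge> 1" using C1 by (simp add: \<omega>0_def)
    fix \<omega> p a b i
    assume w0: "\<omega> \<ge> \<omega>0" and s: "p div W \<omega> = [:b, a:]" and deg: "degree p \<le> 2 * N + 1"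
      and orth: "\<And>i. i \<in> J \<Longrightarrow> osc \<omega> (p * E \<omega> i) = 0" and K0: "cmod a + cmod b > 0"
      and lb: "(cmod a + cmod b) / 4 \<le> cmod (poly [:b, a:] (nd \<omega> i))" and i: "i \<in> J"
    have w: "\<omega> \<ge> 1" "\<omega> \<ge> \<omega>1" "8 * B \<le> \<omega>" using w0 C1(2) by (auto simp: \<omega>0_def)
    define K where "K = cmod a + cmod b"
    define u where "u = (\<lambda>j. poly (p mod W \<omega>) (nd \<omega> j) / poly (E \<omega> j) (nd \<omega> j))"
    define e where "e = cmod (poly (E \<omega> i) (nd \<omega> i))"
    have e: "e > 0" using poly_E_nd_self[OF w(1) i] by (simp add: e_def)
    have p: "p = [:b, a:] * W \<omega> + (\<Sum>j\<in>J. smult (u j) (E \<omega> j))"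
      unfolding u_def s[symmetric] by (rule lagrange_decomposition[OF w(1)])
    have u: "cmod (u j) \<le> C1 * K / \<omega>\<^sup>2" if "j \<in> J" for j
      unfolding K_def by (rule C1(3)[OF w(2) _ that]) (use orth p in simp)
    have "poly p (nd \<omega> i) = (\<Sum>j\<in>J. u j * poly (E \<omega> j) (nd \<omega> i))"
      by (subst p) (simp add: poly_sum poly_W_nd[OF i])
    also have "\<dots> = (\<Sum>j\<in>{i}. u j * poly (E \<omega> j) (nd \<omega> i))"
      using i poly_E_nd[OF w(1) i] by (intro sum.mono_neutral_right) auto
    finally have "cmod (poly p (nd \<omega> i)) = cmod (u i) * e" by (simp add: norm_mult e_def)
    also have "\<dots> \<le> C1 * K / \<omega>\<^sup>2 * e" using u[OF i] e by (intro mult_right_mono) auto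
    finally have pv: "cmod (poly p (nd \<omega> i)) \<le> C1 * K / \<omega>\<^sup>2 * e" .
    have "poly (pderiv p) (nd \<omega> i) = poly [:b, a:] (nd \<omega> i) * poly (E \<omega> i) (nd \<omega> i) 
        + (\<Sum>j\<in>J. u j * poly (pderiv (E \<omega> j)) (nd \<omega> i))"
      by (subst p, simp only: pderiv_add pderiv_mult pderiv_sum pderiv_smult)
         (simp add: poly_sum poly_W_nd[OF i] pderiv_W_nd[OF i] algebra_simps)
    hence "cmod (poly [:b, a:] (nd \<omega> i)) * e = 
        cmod (poly (pderiv p) (nd \<omega> i) - (\<Sum>j\<in>J. u j * poly (pderiv (E \<omega> j)) (nd \<omega> i)))"
      by (simp only: e_def norm_mult add_diff_cancel_right')
    also have "\<dots> \<le> cmod (poly (pderiv p) (nd \<omega> i)) 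
        + cmod (\<Sum>j\<in>J. u j * poly (pderiv (E \<omega> j)) (nd \<omega> i))"
      by (rule norm_triangle_ineq4)
    also have "cmod (\<Sum>j\<in>J. u j * poly (pderiv (E \<omega> j)) (nd \<omega> i)) 
        \<le> (\<Sum>j\<in>J. C1 * K / \<omega>\<^sup>2 * (2 * N * e * \<omega> / \<eta>))"
    proof (rule sum_norm_le)
      fix j assume j: "j \<in> J"
      have "cmod (poly (pderiv (E \<omega> j)) (nd \<omega> i)) * (\<eta> / \<omega>) \<le> 2 * N * e"
        unfolding e_def using \<eta>(2)[OF w(1)] by (intro pderiv_E_bound w i j \<eta>) auto
      hence "cmod (poly (pderiv (E \<omega> j)) (nd \<omega> i)) \<le> 2 * N * e * \<omega> / \<eta>"
        using \<eta>(1) w(1) by (simp add: field_simps)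
      thus "cmod (u j * poly (pderiv (E \<omega> j)) (nd \<omega> i)) \<le> C1 * K / \<omega>\<^sup>2 * (2 * N * e * \<omega> / \<eta>)"
        unfolding norm_mult using u[OF j] C1(1) K0 by (intro mult_mono) (auto simp: K_def)
    qed
    also have "\<dots> = B / \<omega> * K * e"
      using w(1) \<eta>(1) by (simp add: B_def field_simps power2_eq_square)
    also have "\<dots> \<le> 1 / 8 * K * e"
      using w K0 e by (intro mult_right_mono) (auto simp: K_def field_simps)
    finally have "cmod (poly [:b, a:] (nd \<omega> i)) * e \<le> cmod (poly (pderiv p) (nd \<omega> i)) + 1 / 8 * K * e"
      by simp
    moreover have "K / 4 * e \<le> cmod (poly [:b, a:] (nd \<omega> i)) * e"
      using lb e by (intro mult_right_mono) (auto simp: K_def)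
    ultimately have dv: "K * e / 8 \<le> cmod (poly (pderiv p) (nd \<omega> i))" by simp
    have "degree p * cmod (poly p (nd \<omega> i)) \<le> R * (C1 * K / \<omega>\<^sup>2 * e)"
      using deg pv R by (intro mult_mono) (auto simp: R_def)
    also have "\<dots> = (8 * (R * C1)) * (K * e / 8) / \<omega>\<^sup>2"
      by simp
    also have "\<dots> < C * (K * e / 8) / \<omega>\<^sup>2"
      using K0 e w(1) by (intro divide_strict_right_mono mult_strict_right_mono) (auto simp: C_def K_def)
    also have "\<dots> = K * e / 8 * (C / \<omega>\<^sup>2)" by simp
    also have "\<dots> \<le> cmod (poly (pderiv p) (nd \<omega> i)) * (C / \<omega>\<^sup>2)"
      using dv C1(1) R by (intro mult_right_mono) (auto simp: C_def)
    finally have "degree p * cmod (poly p (nd \<omega> i)) < cmod (poly (pderiv p) (nd \<omega> i)) * (C / \<omega>\<^sup>2)" .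
    then obtain z where "poly p z = 0" "cmod (z - nd \<omega> i) < C / \<omega>\<^sup>2"
      using \<open>C \<ge> 0\<close> by (elim root_near) auto
    thus "\<exists>z. poly p z = 0 \<and> cmod (z - nd \<omega> i) \<le> C / \<omega>\<^sup>2" by (intro exI[of _ z]) auto
  qed
qed

end

subsection \<open>Symmetry and existence\<close>

lemma is_orth_poly_iff:
  assumes "\<omega> \<noteq> 0"
  shows "is_orth_poly n \<omega> p \<longleftrightarrow> degree p = n \<and> lead_coeff p = 1 \<and> (\<forall>k<n. osc \<omega> (p * monom 1 k) = 0)"
proof -
  have "integral {-1..1} (\<lambda>x::real. poly p (of_real x) * of_real x ^ k * exp (\<i> * of_real (\<omega> * x)))
     = \<i> / of_real \<omega> * osc \<omega> (p * monom 1 k)" for k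
    using integral_unique[OF has_integral_osc[OF assms, of "p * monom 1 k"]]
    by (simp add: poly_monom)
  thus ?thesis using assms by (simp add: is_orth_poly_def)
qed

lemma osc_mult_eq_0:
  assumes "\<And>k. k < n \<Longrightarrow> osc \<omega> (p * monom 1 k) = 0" "degree g < n"
  shows "osc \<omega> (p * g) = 0"
proof -
  have "p * g = (\<Sum>i\<le>degree g. smult (coeff g i) (p * monom 1 i))"
    by (subst poly_as_sum_of_monoms[symmetric]) 
       (simp add: sum_distrib_left mult_smult_right[symmetric] smult_monom del: mult_smult_right)
  also have "osc \<omega> \<dots> = 0"
    unfolding osc_sum osc_smult using assms by (intro sum.neutral) auto
  finally show ?thesis .
qed

lemma monic_div:
  fixes p q :: "'a::field poly"
  assumes "lead_coeff p = 1" "lead_coeff q = 1" "degree q \<le> degree p"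
  shows "degree (p div q) = degree p - degree q" "lead_coeff (p div q) = 1"
proof -
  define s where "s = p div q"
  define r where "r = p mod q"
  have p: "p = s * q + r" by (simp add: s_def r_def)
  have q0: "q \<noteq> 0" using assms(2) by auto
  have p0: "p \<noteq> 0" using assms(1) by auto
  have r: "r = 0 \<or> degree r < degree q" unfolding r_def using q0 by (rule degree_mod_less)
  have s0: "s \<noteq> 0" using p r assms(3) p0 by auto
  have d: "degree (s * q) = degree s + degree q" using s0 q0 by (rule degree_mult_eq)
  have *: "degree p = degree (s * q) \<and> coeff p (degree p) = coeff (s * q) (degree (s * q))"
  proof (cases "r = 0")
    case False
    hence "degree r < degree (s * q)" using r d by auto
    thus ?thesis unfolding p by (simp add: degree_add_eq_left coeff_eq_0)
  qed (simp add: p)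
  show "degree (p div q) = degree p - degree q" using * d by (simp flip: s_def)
  have "lead_coeff (s * q) = 1" using * assms(1) by simp
  thus "lead_coeff (p div q) = 1" using assms(2) by (simp add: lead_coeff_mult flip: s_def)
qed

section \<open>Reflection in the imaginary axis\<close>

definition reflect :: "complex poly \<Rightarrow> complex poly" where
  "reflect p = pcompose (map_poly cnj p) [:0, -1:]"

text \<open>Identifies the symmetry: zeros move by x -> -cnj x, the mirror image in the imaginary
  axis.\<close>

lemma poly_reflect: "poly (reflect p) x = cnj (poly p (- cnj x))"
  by (simp add: reflect_def poly_pcompose)

lemma reflect_eqI: "(\<And>x. cnj (poly p (- cnj x)) = poly q x) \<Longrightarrow> reflect p = q"
  by (simp add: poly_eq_poly_eq_iff[symmetric] fun_eq_iff poly_reflect)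

lemma reflect_add: "reflect (p + q) = reflect p + reflect q"
  by (rule reflect_eqI) (simp add: poly_reflect)

lemma reflect_mult: "reflect (p * q) = reflect p * reflect q"
  by (rule reflect_eqI) (simp add: poly_reflect)

lemma reflect_prod: "reflect (\<Prod>i\<in>A. f i) = (\<Prod>i\<in>A. reflect (f i))"
  by (rule reflect_eqI) (simp add: poly_reflect poly_prod)

lemma reflect_pCons: "reflect [:a, b:] = [:cnj a, - cnj b:]"
  by (rule reflect_eqI) simp

lemma reflect_monom: "reflect (monom 1 k) = smult ((-1) ^ k) (monom 1 k)"
  by (rule reflect_eqI) (simp add: poly_monom power_minus')

lemma degree_reflect: "degree (reflect p) = degree p"
  by (simp add: reflect_def degree_pcompose degree_map_poly)

lemma lead_coeff_reflect: "lead_coeff (reflect p) = (-1) ^ degree p * cnj (lead_coeff p)"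
  by (simp add: reflect_def lead_coeff_comp degree_map_poly coeff_map_poly mult.commute)

lemma Lam_cnj: "Lam (map_poly cnj f) = cnj (Lam f)"
  by (simp add: Lam_def degree_map_poly coeff_map_poly)

text \<open>Since i/omega is imaginary, -cnj exchanges sigma + delta t and -sigma + delta t for real
  t. The endpoint terms trade places and their phases are conjugate, which yields the minus
  sign.\<close>

lemma osc_reflect: "osc \<omega> (reflect f) = - cnj (osc \<omega> f)"
proof -
  have "pcompose (reflect f) [:\<sigma>, \<i> / of_real \<omega>:] = map_poly cnj (pcompose f [:-\<sigma>, \<i> / of_real \<omega>:])"
    if "\<sigma> = 1 \<or> \<sigma> = -1" for \<sigma>
    using that by (auto simp: poly_eq_poly_eq_iff[symmetric] fun_eq_iff poly_reflect poly_pcompose)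
  thus ?thesis
    by (simp add: osc_def Lam_cnj exp_cnj)
qed

text \<open>The sign restores the leading coefficient 1. Wherever the orthogonal polynomial is
  unique, it coincides with this reflection.\<close>

lemma is_orth_poly_reflect:
  assumes "\<omega> \<noteq> 0" "is_orth_poly n \<omega> p"
  shows "is_orth_poly n \<omega> (smult ((-1) ^ n) (reflect p))"
proof -
  have p: "degree p = n" "lead_coeff p = 1" "\<And>k. k < n \<Longrightarrow> osc \<omega> (p * monom 1 k) = 0"
    using assms by (auto simp: is_orth_poly_iff)
  have "osc \<omega> (reflect p * monom 1 k) = 0" if "k < n" for k
  proof -
    have "reflect p * monom 1 k = smult ((-1) ^ k) (reflect (p * monom 1 k))"
      by (simp add: reflect_mult reflect_monom flip: power_mult_distrib)
    thus ?thesis using p(3)[OF that] by (simp add: osc_smult osc_reflect)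
  qed
  moreover have "lead_coeff (reflect p) = (-1) ^ n" using p(1,2) lead_coeff_reflect[of p] by simp
  hence "lead_coeff (smult ((-1) ^ n) (reflect p)) = 1"
    by (simp flip: power_mult_distrib)
  ultimately show ?thesis
    using assms(1) p(1) by (simp add: is_orth_poly_iff degree_reflect osc_smult)
qed

text \<open>Counting zeros in the two half planes: reflection preserves the multiset of zeros.\<close>

lemma unpaired_root_imaginary:
  fixes z :: "nat \<Rightarrow> complex"
  assumes p: "p = [:- y, 1:] * (\<Prod>j\<in>{1..2*N}. [:- z j, 1:])" and sym: "reflect p = - p"
    and pos: "\<And>j. j \<in> {1..2*N} \<Longrightarrow> 0 < Re (z j) \<longleftrightarrow> j \<le> N"
    and neg: "\<And>j. j \<in> {1..2*N} \<Longrightarrow> Re (z j) < 0 \<longleftrightarrow> N < j"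
  shows "Re y = 0"
proof -
  \<comment> \<open>\<open>F\<close> counts zeros in the open right half plane. The N labelled zeros
    there match the N reflected ones from the left, so y and -cnj y have the same count, which is
    possible only on the imaginary axis.\<close>
  define F where "F = (\<lambda>M :: complex multiset. size {#x \<in># M. Re x > 0#})"
  have F: "F (A + B) = F A + F B" "F {#} = 0" "F {#x#} = (if Re x > 0 then 1 else 0)" for A B x
    by (auto simp: F_def)
  have Fsum: "F (\<Sum>j\<in>S. G j) = (\<Sum>j\<in>S. F (G j))" for S :: "nat set" and G
    by (induction S rule: infinite_finite_induct) (auto simp: F)
  have nz: "(\<Prod>j\<in>{1..2*N}. [:- z j, 1:]) \<noteq> 0" "(\<Prod>j\<in>{1..2*N}. [:cnj (z j), 1:]) \<noteq> 0" by auto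
  have r: "reflect [:- a, 1:] = smult (-1) [:cnj a, 1:]" for a
    by (simp add: reflect_pCons)
  define X where "X = [:cnj y, 1:] * (\<Prod>j\<in>{1..2*N}. [:cnj (z j), 1:])"
  have "reflect p = smult (-1) X"
    unfolding p X_def reflect_mult reflect_prod r prod_smult by simp
  hence "p = X" using sym by simp
  hence "proots p = {#- cnj y#} + (\<Sum>j\<in>{1..2*N}. {#- cnj (z j)#})"
    using nz(2) unfolding X_def by (simp only:) (subst proots_mult, auto simp: proots_prod)
  moreover have "proots p = {#y#} + (\<Sum>j\<in>{1..2*N}. {#z j#})"
    using nz(1) unfolding p by (subst proots_mult) (auto simp: proots_prod)
  ultimately have "F ({#y#} + (\<Sum>j\<in>{1..2*N}. {#z j#})) = F ({#- cnj y#} + (\<Sum>j\<in>{1..2*N}. {#- cnj (z j)#}))"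
    by simp
  hence "F {#y#} + (\<Sum>j\<in>{1..2*N}. F {#z j#}) = F {#- cnj y#} + (\<Sum>j\<in>{1..2*N}. F {#- cnj (z j)#})"
    by (simp only: F(1) Fsum)
  moreover have "(\<Sum>j\<in>{1..2*N}. F {#z j#}) = (\<Sum>j\<in>{1..N}. 1)"
    by (rule sum.mono_neutral_cong_right) (auto simp: F pos)
  moreover have "(\<Sum>j\<in>{1..2*N}. F {#- cnj (z j)#}) = (\<Sum>j\<in>{N+1..2*N}. 1)"
    by (rule sum.mono_neutral_cong_right) (auto simp: F neg)
  ultimately have "F {#y#} = F {#- cnj y#}" by simp
  thus ?thesis by (auto simp: F(3) split: if_splits)
qed

section \<open>Existence in even degree and labelling of the zeros\<close>

context laguerre_nodes
begin

text \<open>Nonsingularity of the moment matrix for large omega: below degree 2N the quotient by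
  \<open>W\<close> is 0, and the coefficient bound with a = b = 0 makes every coefficient
  vanish.\<close>

lemma orth_poly_trivial:
  obtains \<omega>0 where "\<omega>0 \<ge> 1" "\<And>\<omega> q. \<omega> \<ge> \<omega>0 \<Longrightarrow> degree q < 2 * N \<Longrightarrow> 
    (\<And>k. k < 2 * N \<Longrightarrow> osc \<omega> (q * monom 1 k) = 0) \<Longrightarrow> q = 0"
proof -
  obtain C \<omega>0 where C: "C \<ge> 0" "\<omega>0 \<ge> 1"
    "\<And>\<omega> a b u j. \<omega> \<ge> \<omega>0 \<Longrightarrow> 
       (\<And>i. i \<in> J \<Longrightarrow> osc \<omega> (([:b, a:] * W \<omega> + (\<Sum>j\<in>J. smult (u j) (E \<omega> j))) * E \<omega> i) = 0) \<Longrightarrow>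
       j \<in> J \<Longrightarrow> cmod (u j) \<le> C * (cmod a + cmod b) / \<omega>\<^sup>2"
    using coefficient_bound by blast
  show ?thesis
  proof (rule that[OF C(2)])
    fix \<omega> q assume w: "\<omega> \<ge> \<omega>0" and d: "degree q < 2 * N" 
      and o: "\<And>k. k < 2 * N \<Longrightarrow> osc \<omega> (q * monom 1 k) = 0"
    define u where "u = (\<lambda>j. poly (q mod W \<omega>) (nd \<omega> j) / poly (E \<omega> j) (nd \<omega> j))"
    have "q div W \<omega> = 0" using d by (simp add: div_poly_less)
    hence q: "q = [:0, 0:] * W \<omega> + (\<Sum>j\<in>J. smult (u j) (E \<omega> j))"
      using lagrange_decomposition[of \<omega> q] w C(2) by (simp add: u_def)
    have "cmod (u j) \<le> C * (cmod 0 + cmod 0) / \<omega>\<^sup>2" if "j \<in> J" for j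
      using w _ that
    proof (rule C(3))
      fix i assume "i \<in> J"
      hence "osc \<omega> (q * E \<omega> i) = 0"
        by (intro osc_mult_eq_0[OF o degree_E_less])
      thus "osc \<omega> (([:0, 0:] * W \<omega> + (\<Sum>j\<in>J. smult (u j) (E \<omega> j))) * E \<omega> i) = 0"
        by (simp only: q[symmetric])
    qed
    hence "\<forall>j\<in>J. u j = 0" by simp
    thus "q = 0" by (subst q) simp
  qed
qed

text \<open>The 2N conditions leave a nonzero polynomial of degree at most 2N. Triviality in lower
  degrees forces its degree to be 2N and, applied to the difference of two monic solutions, gives
  uniqueness.\<close>

lemma orth_poly_exists_even:
  obtains \<omega>0 where "\<omega>0 \<ge> 1" "\<And>\<omega>. \<omega> \<ge> \<omega>0 \<Longrightarrow> orth_poly_exists (2 * N) \<omega>"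
proof -
  obtain \<omega>0 where w0: "\<omega>0 \<ge> 1" and triv: "\<And>\<omega> q. \<omega> \<ge> \<omega>0 \<Longrightarrow> degree q < 2 * N \<Longrightarrow> 
    (\<And>k. k < 2 * N \<Longrightarrow> osc \<omega> (q * monom 1 k) = 0) \<Longrightarrow> q = 0"
    using orth_poly_trivial by blast
  show ?thesis
  proof (rule that[OF w0])
    fix \<omega> assume w: "\<omega> \<ge> \<omega>0"
    hence wnz: "\<omega> \<noteq> 0" using w0 by simp
    have "\<exists>q. q \<noteq> 0 \<and> degree q \<le> 2 * N \<and> (\<forall>k<2 * N. osc \<omega> (q * monom 1 k) = 0)"
      by (rule exists_poly_in_kernel) (simp add: left_diff_distrib osc_diff osc_smult)
    then obtain q where q: "q \<noteq> 0" "degree q \<le> 2 * N" "\<And>k. k < 2 * N \<Longrightarrow> osc \<omega> (q * monom 1 k) = 0"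
      by blast
    have d: "degree q = 2 * N" using triv[OF w _ q(3)] q(1,2) by fastforce
    have nz: "coeff q (2 * N) \<noteq> 0" using q(1) leading_coeff_neq_0[of q] unfolding d by blast
    define p where "p = smult (inverse (lead_coeff q)) q"
    have p: "is_orth_poly (2 * N) \<omega> p"
      using q nz d by (simp add: is_orth_poly_iff[OF wnz] p_def osc_smult)
    show "orth_poly_exists (2 * N) \<omega>"
      unfolding orth_poly_exists_def
    proof (rule ex1I)
      show "is_orth_poly (2 * N) \<omega> p" by (rule p)
      fix p' assume p': "is_orth_poly (2 * N) \<omega> p'"
      have dd: "degree (p' - p) \<le> 2 * N" "coeff (p' - p) (2 * N) = 0"
        using p p' by (auto simp: is_orth_poly_iff[OF wnz] intro!: degree_diff_le)
      have "degree (p' - p) < 2 * N"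
        using eq_zero_or_degree_less[OF dd] N1 by auto
      moreover have "osc \<omega> ((p' - p) * monom 1 k) = 0" if "k < 2 * N" for k
        using p p' that by (simp add: is_orth_poly_iff[OF wnz] left_diff_distrib osc_diff)
      ultimately have "p' - p = 0" by (rule triv[OF w])
      thus "p' = p" by simp
    qed
  qed
qed

text \<open>Labels up to N belong to the endpoint 1, the others to -1. The half-plane clause serves
  the zero count in odd degree.\<close>

definition labels_roots :: "real \<Rightarrow> real \<Rightarrow> complex poly \<Rightarrow> (nat \<Rightarrow> complex) \<Rightarrow> bool" where
  "labels_roots C \<omega> p z \<longleftrightarrow> inj_on z {1..2*N} \<and> (\<forall>j\<in>{1..2*N}. poly p (z j) = 0) \<and>
          (\<forall>k\<in>{1..N}.
              cmod (z k - (1 + \<i> * complex_of_real (c k / \<omega>))) \<le> C / \<omega>\<^sup>2 \<and>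
              cmod (z (N + k) - (-1 + \<i> * complex_of_real (c k / \<omega>))) \<le> C / \<omega>\<^sup>2) \<and>
          (\<forall>j\<in>{1..2*N}. (0 < Re (z j) \<longleftrightarrow> j \<le> N) \<and> (Re (z j) < 0 \<longleftrightarrow> N < j))"

lemma labelled_roots:
  "\<exists>C \<omega>0. \<omega>0 \<ge> 1 \<and> (\<forall>\<omega> p a b. \<omega> \<ge> \<omega>0 \<longrightarrow> p div W \<omega> = [:b, a:] \<longrightarrow>
      (\<forall>k<2 * N. osc \<omega> (p * monom 1 k) = 0) \<longrightarrow> degree p \<le> 2 * N + 1 \<longrightarrow>
      cmod a + cmod b > 0 \<longrightarrow>
      (\<forall>i\<in>J. (cmod a + cmod b) / 4 \<le> cmod (poly [:b, a:] (nd \<omega> i))) \<longrightarrow>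
      (\<exists>z. labels_roots C \<omega> p z))"
proof -
  obtain C \<omega>1 where C: "C \<ge> 0" "\<omega>1 \<ge> 1"
    "\<And>\<omega> p a b i. \<omega> \<ge> \<omega>1 \<Longrightarrow> p div W \<omega> = [:b, a:] \<Longrightarrow> degree p \<le> 2 * N + 1 \<Longrightarrow>
      (\<And>i. i \<in> J \<Longrightarrow> osc \<omega> (p * E \<omega> i) = 0) \<Longrightarrow> cmod a + cmod b > 0 \<Longrightarrow>
      (cmod a + cmod b) / 4 \<le> cmod (poly [:b, a:] (nd \<omega> i)) \<Longrightarrow> i \<in> J \<Longrightarrow>
      \<exists>z. poly p z = 0 \<and> cmod (z - nd \<omega> i) \<le> C / \<omega>\<^sup>2"
    using roots_near_nodes by blast
  obtain \<eta> where \<eta>: "\<eta> > 0" "\<And>\<omega> i j. \<omega> \<ge> 1 \<Longrightarrow> i \<in> J \<Longrightarrow> j \<in> J \<Longrightarrow> i \<noteq> j \<Longrightarrow>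
     \<eta> / \<omega> \<le> cmod (nd \<omega> i - nd \<omega> j)"
    using nodes_separated by blast
  \<comment> \<open>The entry 2C + 1 gives C/omega^2 < 1, so each zero has a real part of the same
    sign as its node; 2C/eta + 1 gives 2C/omega^2 < eta/omega, so zeros found at different nodes are
    distinct.\<close>
  define \<omega>0 where "\<omega>0 = Max {\<omega>1, 2 * C + 1, 2 * C / \<eta> + 1}"
  show ?thesis
  proof (rule exI[of _ C], rule exI[of _ \<omega>0], intro conjI allI impI)
    show "\<omega>0 \<ge> 1" using C(2) by (simp add: \<omega>0_def)
    fix \<omega> p a b
    assume w0: "\<omega> \<ge> \<omega>0" and s: "p div W \<omega> = [:b, a:]" 
      and o': "\<forall>k<2 * N. osc \<omega> (p * monom 1 k) = 0" and d: "degree p \<le> 2 * N + 1"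
      and K: "cmod a + cmod b > 0" 
      and lb': "\<forall>i\<in>J. (cmod a + cmod b) / 4 \<le> cmod (poly [:b, a:] (nd \<omega> i))"
    note o = o'[rule_format] and lb = lb'[rule_format]
    have w: "\<omega> \<ge> \<omega>1" "\<omega> \<ge> 1" "2 * C < \<omega>" "2 * C / \<eta> < \<omega>" using w0 C(2) by (auto simp: \<omega>0_def)
    have orth: "osc \<omega> (p * E \<omega> i) = 0" if "i \<in> J" for i
      using that by (intro osc_mult_eq_0[OF o degree_E_less])
    have "\<forall>i\<in>J. \<exists>z. poly p z = 0 \<and> cmod (z - nd \<omega> i) \<le> C / \<omega>\<^sup>2"
      using C(3)[OF w(1) s d orth K lb] by blast
    then obtain \<zeta> where \<zeta>: "\<And>i. i \<in> J \<Longrightarrow> poly p (\<zeta> i) = 0" "\<And>i. i \<in> J \<Longrightarrow> cmod (\<zeta> i - nd \<omega> i) \<le> C / \<omega>\<^sup>2"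
      by metis
    have small: "C / \<omega>\<^sup>2 < 1"
    proof -
      have "2 * C < \<omega> * 1" using w(3) by simp
      also have "\<dots> \<le> \<omega> * \<omega>" using w(2) by (intro mult_left_mono) auto
      finally show ?thesis using w(2) C(1) by (simp add: field_simps power2_eq_square)
    qed
    have sep: "2 * (C / \<omega>\<^sup>2) < \<eta> / \<omega>"
    proof -
      have "2 * C < \<eta> * \<omega>" using w(4) \<eta>(1) by (simp add: field_simps)
      hence "2 * C / \<omega>\<^sup>2 < \<eta> * \<omega> / \<omega>\<^sup>2" using w(2) by (intro divide_strict_right_mono) auto
      thus ?thesis using w(2) by (simp add: power2_eq_square)
    qed
    have inj: "i = j" if "i \<in> J" "j \<in> J" "\<zeta> i = \<zeta> j" for i j
    proof (rule ccontr)
      assume "i \<noteq> j"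
      hence "\<eta> / \<omega> \<le> cmod (nd \<omega> i - nd \<omega> j)" using \<eta>(2)[OF w(2) that(1,2)] by blast
      also have "nd \<omega> i - nd \<omega> j = (\<zeta> j - nd \<omega> j) - (\<zeta> i - nd \<omega> i)" using that(3) by simp
      also have "cmod \<dots> \<le> cmod (\<zeta> j - nd \<omega> j) + cmod (\<zeta> i - nd \<omega> i)" by (rule norm_triangle_ineq4)
      also have "\<dots> \<le> 2 * (C / \<omega>\<^sup>2)" using \<zeta>(2)[OF that(1)] \<zeta>(2)[OF that(2)] by simp
      finally show False using sep by simp
    qed
    define idx where "idx = (\<lambda>j. if j \<le> N then (1 :: complex, j) else (-1, j - N))"
    have idx: "idx j \<in> J" if "j \<in> {1..2*N}" for j
      using that by (auto simp: idx_def J_def I_def)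
    have idx_inj: "inj_on idx {1..2*N}"
      by (auto simp: inj_on_def idx_def split: if_splits)
    have re: "\<bar>Re (\<zeta> i) - Re (fst i)\<bar> < 1" if "i \<in> J" for i
    proof -
      have "\<bar>Re (\<zeta> i - nd \<omega> i)\<bar> \<le> cmod (\<zeta> i - nd \<omega> i)" by (rule abs_Re_le_cmod)
      also have "\<dots> < 1" using \<zeta>(2)[OF that] small by simp
      finally show ?thesis by (simp add: Re_nd)
    qed
    show "\<exists>z. labels_roots C \<omega> p z"
      unfolding labels_roots_def
    proof (intro exI[of _ "\<zeta> \<circ> idx"] conjI ballI)
      show "inj_on (\<zeta> \<circ> idx) {1..2*N}"
      proof (rule comp_inj_on[OF idx_inj], rule inj_onI)
        fix i j assume ij: "i \<in> idx ` {1..2*N}" "j \<in> idx ` {1..2*N}" "\<zeta> i = \<zeta> j"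
        have "idx ` {1..2*N} \<subseteq> J" using idx by blast
        with ij show "i = j" by (intro inj) auto
      qed
      show "poly p ((\<zeta> \<circ> idx) j) = 0" if "j \<in> {1..2*N}" for j
        using \<zeta>(1)[OF idx[OF that]] by simp
      fix k assume k: "k \<in> {1..N}"
      show "cmod ((\<zeta> \<circ> idx) k - (1 + \<i> * complex_of_real (c k / \<omega>))) \<le> C / \<omega>\<^sup>2"
        using \<zeta>(2)[OF idx[of k]] k by (simp add: idx_def nd_def dd_def)
      show "cmod ((\<zeta> \<circ> idx) (N + k) - (-1 + \<i> * complex_of_real (c k / \<omega>))) \<le> C / \<omega>\<^sup>2"
        using \<zeta>(2)[OF idx[of "N + k"]] k by (simp add: idx_def nd_def dd_def)
    next
      fix j assume j: "j \<in> {1..2*N}"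
      show "0 < Re ((\<zeta> \<circ> idx) j) \<longleftrightarrow> j \<le> N" "Re ((\<zeta> \<circ> idx) j) < 0 \<longleftrightarrow> N < j"
        using re[OF idx[OF j]] by (auto simp: idx_def split: if_splits)
    qed
  qed
qed

section \<open>The symmetric quotient in odd degree\<close>

lemma reflect_W: "reflect (W \<omega>) = W \<omega>"
proof -
  have r: "reflect [:- (\<sigma> + dd \<omega> * of_real x), 1:] = smult (-1) [:- (- \<sigma> + dd \<omega> * of_real x), 1:]"
    if "\<sigma> \<in> {1, -1}" for \<sigma> x
    using that by (auto simp: reflect_pCons dd_def)
  have "reflect (W \<omega>) = smult ((-1) ^ N) (\<Prod>k\<in>I. [:- (- 1 + dd \<omega> * of_real (c k)), 1:]) 
       * smult ((-1) ^ N) (\<Prod>k\<in>I. [:- (- (- 1) + dd \<omega> * of_real (c k)), 1:])"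
    unfolding W_def V_def reflect_mult reflect_prod by (simp only: r insertI1 insertI2 prod_smult prod_constant card_I)
  also have "\<dots> = W \<omega>"
    by (simp add: W_def V_def mult.commute flip: power_mult_distrib)
  finally show ?thesis .
qed

text \<open>As \<open>W\<close> is fixed by reflection, reflecting p = s W + r and comparing degrees
  gives reflect s = -s. For s = x + b this reads cnj b = -b.\<close>

lemma quotient_shift_imaginary:
  assumes "p div W \<omega> = [:b, 1:]" "reflect p = - p"
  shows "Re b = 0"
proof -
  define s r where "s = p div W \<omega>" and "r = p mod W \<omega>"
  have p: "p = s * W \<omega> + r" by (simp add: s_def r_def)
  have r: "degree r < 2 * N"
    using degree_mod_less'[of "W \<omega>" p] N1 by (cases "r = 0") (auto simp: r_def)
  have "reflect s * W \<omega> + reflect r = - (s * W \<omega> + r)"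
    using assms(2) unfolding p reflect_add reflect_mult reflect_W .
  hence eq: "(reflect s + s) * W \<omega> = - (reflect r + r)"
    by (simp add: algebra_simps eq_neg_iff_add_eq_0)
  have "reflect s + s = 0"
  proof (rule ccontr)
    assume "reflect s + s \<noteq> 0"
    hence "2 * N \<le> degree ((reflect s + s) * W \<omega>)" by (subst degree_mult_eq) auto
    also have "\<dots> = degree (reflect r + r)" unfolding eq by (rule degree_minus)
    also have "\<dots> < 2 * N" using r by (intro degree_add_less) (simp_all add: degree_reflect)
    finally show False by simp
  qed
  hence "cnj b + b = 0" using assms(1) by (simp add: s_def reflect_pCons)
  thus ?thesis by (simp add: complex_eq_iff)
qed

lemma zero_asymptotics:
  "\<exists>C \<omega>0. \<forall>\<omega>\<ge>\<omega>0.
     orth_poly_exists (2*N) \<omega> \<and>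
     (\<forall>p. is_orth_poly (2*N) \<omega> p \<longrightarrow>
        (\<exists>z :: nat \<Rightarrow> complex.
           p = (\<Prod>j\<in>{1..2*N}. [:- z j, 1:]) \<and>
           (\<forall>k\<in>{1..N}.
              cmod (z k - (1 + \<i> * complex_of_real (c k / \<omega>))) \<le> C / \<omega>\<^sup>2 \<and>
              cmod (z (N + k) - (-1 + \<i> * complex_of_real (c k / \<omega>))) \<le> C / \<omega>\<^sup>2))) \<and>
     (orth_poly_exists (2*N+1) \<omega> \<longrightarrow>
       (\<forall>p. is_orth_poly (2*N+1) \<omega> p \<longrightarrow>
        (\<exists>(z :: nat \<Rightarrow> complex) y.
           Re y = 0 \<and>
           p = [:- y, 1:] * (\<Prod>j\<in>{1..2*N}. [:- z j, 1:]) \<and>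
           (\<forall>k\<in>{1..N}.
              cmod (z k - (1 + \<i> * complex_of_real (c k / \<omega>))) \<le> C / \<omega>\<^sup>2 \<and>
              cmod (z (N + k) - (-1 + \<i> * complex_of_real (c k / \<omega>))) \<le> C / \<omega>\<^sup>2))))"
proof -
  obtain \<omega>1 where w1: "\<omega>1 \<ge> 1" "\<And>\<omega>. \<omega> \<ge> \<omega>1 \<Longrightarrow> orth_poly_exists (2 * N) \<omega>"
    using orth_poly_exists_even by blast
  obtain C \<omega>2 where "\<omega>2 \<ge> 1 \<and> (\<forall>\<omega> p a b. \<omega> \<ge> \<omega>2 \<longrightarrow> p div W \<omega> = [:b, a:] \<longrightarrow>
      (\<forall>k<2 * N. osc \<omega> (p * monom 1 k) = 0) \<longrightarrow> degree p \<le> 2 * N + 1 \<longrightarrow>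
      cmod a + cmod b > 0 \<longrightarrow>
      (\<forall>i\<in>J. (cmod a + cmod b) / 4 \<le> cmod (poly [:b, a:] (nd \<omega> i))) \<longrightarrow>
      (\<exists>z. labels_roots C \<omega> p z))"
    using labelled_roots by (elim exE)
  hence w2: "\<omega>2 \<ge> 1" and roots:
    "\<And>\<omega> p a b. \<omega> \<ge> \<omega>2 \<Longrightarrow> p div W \<omega> = [:b, a:] \<Longrightarrow> 
      (\<And>k. k < 2 * N \<Longrightarrow> osc \<omega> (p * monom 1 k) = 0) \<Longrightarrow> degree p \<le> 2 * N + 1 \<Longrightarrow>
      cmod a + cmod b > 0 \<Longrightarrow>
      (\<And>i. i \<in> J \<Longrightarrow> (cmod a + cmod b) / 4 \<le> cmod (poly [:b, a:] (nd \<omega> i))) \<Longrightarrow>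
      \<exists>z. labels_roots C \<omega> p z"
    by blast+
  show ?thesis
  \<comment> \<open>The sum of the |c_k| is a crude bound for each of them; for omega beyond it
    every node has modulus at most 2.\<close>
  proof (rule exI[of _ C], rule exI[of _ "Max {\<omega>1, \<omega>2, (\<Sum>k\<in>I. \<bar>c k\<bar>)}"], intro allI impI conjI)
    fix \<omega> assume "Max {\<omega>1, \<omega>2, (\<Sum>k\<in>I. \<bar>c k\<bar>)} \<le> \<omega>"
    hence w: "\<omega> \<ge> \<omega>1" "\<omega> \<ge> \<omega>2" "\<omega> \<ge> 1" and wc: "(\<Sum>k\<in>I. \<bar>c k\<bar>) \<le> \<omega>" using w1 by auto
    hence wnz: "\<omega> \<noteq> 0" by simp
    show "orth_poly_exists (2 * N) \<omega>" using w1 w by simp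
    {
      fix p assume p: "is_orth_poly (2 * N) \<omega> p"
      hence p': "degree p = 2 * N" "lead_coeff p = 1" "\<And>k. k < 2 * N \<Longrightarrow> osc \<omega> (p * monom 1 k) = 0"
        using is_orth_poly_iff[OF wnz] by auto
      have "degree (p div W \<omega>) = 0" "lead_coeff (p div W \<omega>) = 1"
        using monic_div[of p "W \<omega>"] p'(1,2) lead_coeff_W by auto
      \<comment> \<open>The constant quotient 1 is written with a = 0 and b = 1, so the required
        lower bound is just 1/4 <= 1.\<close>
      hence s: "p div W \<omega> = [:1, 0:]" by (auto elim!: degree_eq_zeroE)
      obtain z where z: "inj_on z {1..2*N}" "\<forall>j\<in>{1..2*N}. poly p (z j) = 0"
          "\<forall>k\<in>{1..N}.
              cmod (z k - (1 + \<i> * complex_of_real (c k / \<omega>))) \<le> C / \<omega>\<^sup>2 \<and>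
              cmod (z (N + k) - (-1 + \<i> * complex_of_real (c k / \<omega>))) \<le> C / \<omega>\<^sup>2"
        using roots[OF w(2) s p'(3)] p'(1) unfolding labels_roots_def by auto
      have "p = (\<Prod>j\<in>{1..2*N}. [:- z j, 1:])"
        using z(1,2) p'(1,2) by (intro monic_eq_prod_roots) auto
      with z(3) show "\<exists>z :: nat \<Rightarrow> complex.
           p = (\<Prod>j\<in>{1..2*N}. [:- z j, 1:]) \<and>
           (\<forall>k\<in>{1..N}.
              cmod (z k - (1 + \<i> * complex_of_real (c k / \<omega>))) \<le> C / \<omega>\<^sup>2 \<and>
              cmod (z (N + k) - (-1 + \<i> * complex_of_real (c k / \<omega>))) \<le> C / \<omega>\<^sup>2)" by blast
    next
      fix p assume ex: "orth_poly_exists (2*N+1) \<omega>" and p: "is_orth_poly (2 * N + 1) \<omega> p"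
      hence p': "degree p = 2 * N + 1" "lead_coeff p = 1" "\<And>k. k < 2 * N \<Longrightarrow> osc \<omega> (p * monom 1 k) = 0"
        using is_orth_poly_iff[OF wnz] by auto
      \<comment> \<open>Uniqueness identifies the normalised reflection with \<open>p\<close>; the
        odd degree then leaves the sign -1.\<close>
      have "smult ((-1) ^ (2 * N + 1)) (reflect p) = p"
        using ex p is_orth_poly_reflect[OF wnz p] unfolding orth_poly_exists_def by blast
      hence "- reflect p = p" by simp
      hence sym: "reflect p = - p" by (metis minus_minus)
      have ds: "degree (p div W \<omega>) = 1" "lead_coeff (p div W \<omega>) = 1"
        using monic_div[of p "W \<omega>"] p'(1,2) lead_coeff_W by auto
      then obtain b where s: "p div W \<omega> = [:b, 1:]"
        by (metis One_nat_def degree1_coeffs pCons_eq_iff coeff_pCons_0 coeff_pCons_Suc)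
      have b: "Re b = 0" using s sym by (rule quotient_shift_imaginary)
      \<comment> \<open>As \<open>b\<close> is imaginary and the node x_i has real part 1 or -1, |b
        + x_i| >= 1. With |x_i| <= 2 this yields 1 + |b| <= 3 + |b + x_i| <= 4 |b + x_i|, whence the
        factor 1/4.\<close>
      have lb: "(cmod 1 + cmod b) / 4 \<le> cmod (poly [:b, 1:] (nd \<omega> i))" if i: "i \<in> J" for i
      proof -
        obtain \<sigma> k where i': "i = (\<sigma>, k)" "\<sigma> \<in> {1, -1}" "k \<in> I" using i by (rule J_cases)
        have "\<bar>c k\<bar> \<le> (\<Sum>k\<in>I. \<bar>c k\<bar>)" using i'(3) by (intro member_le_sum) auto
        hence "\<bar>c k\<bar> / \<omega> \<le> 1" using wc w(3) by (simp add: field_simps)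
        moreover have "cmod (nd \<omega> i) \<le> cmod \<sigma> + cmod (dd \<omega> * of_real (c k))"
          unfolding nd_def i' fst_conv snd_conv by (rule norm_triangle_ineq)
        hence "cmod (nd \<omega> i) \<le> 1 + \<bar>c k\<bar> / \<omega>"
          using i'(2) w(3) by (auto simp: norm_mult norm_dd)
        ultimately have "cmod (nd \<omega> i) \<le> 2" by simp
        moreover have "cmod b \<le> cmod (b + nd \<omega> i) + cmod (nd \<omega> i)"
          by (metis add_diff_cancel_right' norm_triangle_ineq4)
        moreover have "\<bar>Re (b + nd \<omega> i)\<bar> \<le> cmod (b + nd \<omega> i)" by (rule abs_Re_le_cmod)
        hence "1 \<le> cmod (b + nd \<omega> i)" using b i'(1,2) by (auto simp: Re_nd)
        ultimately show ?thesis by simp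
      qed
      have K: "cmod 1 + cmod b > 0" by (simp add: add_pos_nonneg)
      obtain z where z: "inj_on z {1..2*N}" "\<forall>j\<in>{1..2*N}. poly p (z j) = 0"
          "\<forall>k\<in>{1..N}.
              cmod (z k - (1 + \<i> * complex_of_real (c k / \<omega>))) \<le> C / \<omega>\<^sup>2 \<and>
              cmod (z (N + k) - (-1 + \<i> * complex_of_real (c k / \<omega>))) \<le> C / \<omega>\<^sup>2"
          "\<And>j. j \<in> {1..2*N} \<Longrightarrow> 0 < Re (z j) \<longleftrightarrow> j \<le> N" "\<And>j. j \<in> {1..2*N} \<Longrightarrow> Re (z j) < 0 \<longleftrightarrow> N < j"
        using roots[OF w(2) s p'(3) _ K lb] p'(1) unfolding labels_roots_def by auto
      define Q where "Q = (\<Prod>j\<in>{1..2*N}. [:- z j, 1:])"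
      have Q: "degree Q = 2 * N" "lead_coeff Q = 1"
        unfolding Q_def lead_coeff_prod by (subst degree_prod_sum_eq) auto
      \<comment> \<open>Dividing out the 2N distinct labelled zeros leaves a monic linear factor;
        its zero y is the only one not yet accounted for.\<close>
      have "Q dvd p" unfolding Q_def using z(1,2) by (intro prod_linear_dvd) auto
      hence pQ: "p = p div Q * Q" by simp
      have "degree (p div Q) = 1" "lead_coeff (p div Q) = 1"
        using monic_div[of p Q] p'(1,2) Q by auto
      then obtain y where y: "p div Q = [:- y, 1:]"
        by (metis One_nat_def degree1_coeffs pCons_eq_iff coeff_pCons_0 coeff_pCons_Suc minus_minus)
      have py: "p = [:- y, 1:] * (\<Prod>j\<in>{1..2*N}. [:- z j, 1:])"
        unfolding y[symmetric] Q_def[symmetric] by (rule pQ)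
      have "Re y = 0" using py sym z(4,5) by (rule unpaired_root_imaginary)
      with py z(3) show "\<exists>(z :: nat \<Rightarrow> complex) y.
           Re y = 0 \<and>
           p = [:- y, 1:] * (\<Prod>j\<in>{1..2*N}. [:- z j, 1:]) \<and>
           (\<forall>k\<in>{1..N}.
              cmod (z k - (1 + \<i> * complex_of_real (c k / \<omega>))) \<le> C / \<omega>\<^sup>2 \<and>
              cmod (z (N + k) - (-1 + \<i> * complex_of_real (c k / \<omega>))) \<le> C / \<omega>\<^sup>2)" by blast
    }
  qed
qed

end

theorem theorem1:
  fixes N :: nat and c :: "nat \<Rightarrow> real"
  assumes "N \<ge> 1"
    and "inj_on c {1..N}"
    and "c ` {1..N} = {x. laguerre N x = 0}"
  shows "\<exists>C \<omega>0. \<forall>\<omega>\<ge>\<omega>0.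
     orth_poly_exists (2*N) \<omega> \<and>
     (\<forall>p. is_orth_poly (2*N) \<omega> p \<longrightarrow>
        (\<exists>z :: nat \<Rightarrow> complex.
           p = (\<Prod>j\<in>{1..2*N}. [:- z j, 1:]) \<and>
           (\<forall>k\<in>{1..N}.
              cmod (z k - (1 + \<i> * complex_of_real (c k / \<omega>))) \<le> C / \<omega>\<^sup>2 \<and>
              cmod (z (N + k) - (-1 + \<i> * complex_of_real (c k / \<omega>))) \<le> C / \<omega>\<^sup>2))) \<and>
     (orth_poly_exists (2*N+1) \<omega> \<longrightarrow>
       (\<forall>p. is_orth_poly (2*N+1) \<omega> p \<longrightarrow>
        (\<exists>(z :: nat \<Rightarrow> complex) y.
           Re y = 0 \<and>
           p = [:- y, 1:] * (\<Prod>j\<in>{1..2*N}. [:- z j, 1:]) \<and>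
           (\<forall>k\<in>{1..N}.
              cmod (z k - (1 + \<i> * complex_of_real (c k / \<omega>))) \<le> C / \<omega>\<^sup>2 \<and>
              cmod (z (N + k) - (-1 + \<i> * complex_of_real (c k / \<omega>))) \<le> C / \<omega>\<^sup>2))))"
proof -
  interpret laguerre_nodes N c
    using assms by unfold_locales auto
  show ?thesis by (rule zero_asymptotics)
qed

end
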